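(* For all $n\ge1$, $$\sum_{\mu\in\mathrm{WComp}_{n-1}}\dim\mathcal{L}ie(\mu)\,\mathbf{x}^\mu=\sum_{\Upsilon\in\mathsf{Nor}_n}e_{\lambda^{\mathsf{Comb}}(\Upsilon)}(\mathbf{x}),$$ where $e_\lambda$ is the elementary symmetric function indexed by the partition $\lambda$.
   Context: Fix a field $\mathbf{k}$. $\mathrm{WComp}_{n}$ is the set of weak compositions $\mu=(\mu(1),\mu(2),\dots)$ with $\sum\mu(i)=n$, and $\mathbf{x}^\mu=x_1^{\mu(1)}x_2^{\mu(2)}\cdots$. $\mathcal{L}ie(\mu)$ ($\mu\in\mathrm{WComp}_{n-1}$) is the subspace of the multilinear component of the free Lie algebra on $[n]$ with compatible Lie brackets $[\cdot,\cdot]_j$, $j\in\mathbb{P}$ (relations: antisymmetry and Jacobi for each bracket, and $[x,[y,z]_j]_i+[z,[x,y]_j]_i+[y,[z,x]_j]_i+[x,[y,z]_i]_j+[z,[x,y]_i]_j+[y,[z,x]_i]_j=0$ for $i\ne j$) spanned by bracketed permutations of $[n]$ with exactly $\mu(j)$ brackets of type $j$. A labeled binary tree on $[n]$ is a planar rooted tree in which each internal node has a left child $L(x)$ and right child $R(x)$, with $n$ leaves labeled bijectively by $[n]$. It is normalized if for each subtree, its leftmost leaf has the smallest label in that subtree; $\mathsf{Nor}_n$ is the set of normalized labeled binary trees on $[n]$. For $\Upsilon\in\mathsf{Nor}_n$, let $\pi^{\mathsf{Comb}}(\Upsilon)$ be the finest set partition of the set of internal nodes of $\Upsilon$ such that whenever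 an internal node $y$ is the right child of an internal node $x$, $x$ and $y$ lie in the same block. The comb type $\lambda^{\mathsf{Comb}}(\Upsilon)$ is the integer partition whose parts are the block sizes of $\pi^{\mathsf{Comb}}(\Upsilon)$. *)

theory Defs
  imports
    Complex_Main
    "HOL-Library.Multiset"
    "HOL-Library.Poly_Mapping"
    "HOL-Library.Disjoint_Sets"
begin

text \<open>
  The index set \<open>{1, 2, 3, ...}\<close> of the variables and of the bracket types is rendered in the
  theorem by the type \<^typ>\<open>num\<close> of positive integers; the definitions are polymorphic in it.
\<close>

section \<open>Formal power series in arbitrarily many commuting variables\<close>

text \<open>
  A monomial \<open>x\<^sup>\<mu>\<close> is represented by its exponent vector \<open>\<mu>\<close>, and a series is an arbitrary family
  of coefficients; infinitely many monomials of the same degree may occur.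
\<close>

typedef ('v, 'a) mps = "UNIV :: (('v \<Rightarrow>\<^sub>0 nat) \<Rightarrow> 'a) set"
  morphisms mps_nth mps_of ..

setup_lifting type_definition_mps

lemma mps_eqI: "(\<And>m. mps_nth f m = mps_nth g m) \<Longrightarrow> f = g"
  by (metis ext mps_nth_inject)

lemma mps_nth_mps_of [simp]: "mps_nth (mps_of f) = f"
  by (simp add: mps_of_inverse)

lemma finite_monomial_splits: "finite {(a, b). a + b = (m :: 'v \<Rightarrow>\<^sub>0 nat)}"
proof -
  define S where "S = {f. \<forall>x.
    (x \<in> Poly_Mapping.keys m \<longrightarrow> f x \<in> {..sum (Poly_Mapping.lookup m) (Poly_Mapping.keys m)}) \<and>
    (x \<notin> Poly_Mapping.keys m \<longrightarrow> f x = 0)}"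
  have fin: "finite S"
    unfolding S_def by (rule finite_set_of_finite_funs) auto
  have "Poly_Mapping.lookup a \<in> S" if m: "a + b = m" for a b
  proof -
    have le: "Poly_Mapping.lookup a x \<le> Poly_Mapping.lookup m x" for x
      unfolding m[symmetric] lookup_add by (rule le_add1)
    have "Poly_Mapping.lookup a x \<le> sum (Poly_Mapping.lookup m) (Poly_Mapping.keys m)"
      if "x \<in> Poly_Mapping.keys m" for x
      using le[of x] member_le_sum[of x "Poly_Mapping.keys m" "Poly_Mapping.lookup m"] that by simp
    moreover have "Poly_Mapping.lookup a x = 0" if "x \<notin> Poly_Mapping.keys m" for x
      using le[of x] that by (simp add: Poly_Mapping.in_keys_iff)
    ultimately show ?thesis
      by (simp add: S_def)
  qed
  hence "Poly_Mapping.lookup ` fst ` {(a, b). a + b = m} \<subseteq> S"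
    unfolding image_image split_def by blast
  hence "finite (Poly_Mapping.lookup ` fst ` {(a, b). a + b = m})"
    using fin finite_subset by blast
  hence "finite (fst ` {(a, b). a + b = m})"
    by (rule finite_imageD) (auto intro!: inj_onI poly_mapping_eqI)
  moreover have "inj_on fst {(a, b). a + b = m}"
  proof (rule inj_onI)
    fix p q assume pq: "p \<in> {(a, b). a + b = m}" "q \<in> {(a, b). a + b = m}" and fst: "fst p = fst q"
    from pq have "fst p + snd p = fst q + snd q" unfolding split_def mem_Collect_eq by metis
    hence "snd p = snd q" unfolding fst by (rule add_left_imp_eq)
    with fst show "p = q" by (rule prod_eqI)
  qed
  ultimately show ?thesis
    by (rule finite_imageD)
qed

instantiation mps :: (type, comm_ring_1) comm_ring_1
begin

lift_definition zero_mps :: "('a, 'b) mps" is "\<lambda>m. 0" .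
lift_definition one_mps :: "('a, 'b) mps" is "\<lambda>m. if m = 0 then 1 else 0" .
lift_definition plus_mps :: "('a, 'b) mps \<Rightarrow> ('a, 'b) mps \<Rightarrow> ('a, 'b) mps"
  is "\<lambda>f g m. f m + g m" .
lift_definition minus_mps :: "('a, 'b) mps \<Rightarrow> ('a, 'b) mps \<Rightarrow> ('a, 'b) mps"
  is "\<lambda>f g m. f m - g m" .
lift_definition uminus_mps :: "('a, 'b) mps \<Rightarrow> ('a, 'b) mps"
  is "\<lambda>f m. - f m" .
lift_definition times_mps :: "('a, 'b) mps \<Rightarrow> ('a, 'b) mps \<Rightarrow> ('a, 'b) mps"
  is "\<lambda>f g m. \<Sum>(a, b) \<in> {(a, b). a + b = m}. f a * g b" .

instance
proof
  fix f g h :: "('a, 'b) mps"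
  show "f + g + h = f + (g + h)" by transfer (simp add: add.assoc)
  show "f + g = g + f" by transfer (simp add: add.commute)
  show "0 + f = f" by transfer simp
  show "- f + f = 0" by transfer simp
  show "f - g = f + - g" by transfer simp
  show "(0 :: ('a, 'b) mps) \<noteq> 1" by transfer (metis zero_neq_one)
  show "(f + g) * h = f * h + g * h"
    by transfer (simp add: distrib_right split_def sum.distrib)
  show "f * g = g * f"
  proof (transfer, rule ext)
    fix f g :: "('a \<Rightarrow>\<^sub>0 nat) \<Rightarrow> 'b" and m
    show "(\<Sum>(a, b) \<in> {(a, b). a + b = m}. f a * g b) = (\<Sum>(a, b) \<in> {(a, b). a + b = m}. g a * f b)"
      by (rule sum.reindex_bij_witness[of _ prod.swap prod.swap])
        (auto simp: add.commute mult.commute)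
  qed
  show "1 * f = f"
  proof (transfer, rule ext)
    fix f :: "('a \<Rightarrow>\<^sub>0 nat) \<Rightarrow> 'b" and m
    have "(\<Sum>(a, b) \<in> {(a, b). a + b = m}. (if a = 0 then 1 else 0) * f b)
        = (\<Sum>(a, b) \<in> {(0 :: 'a \<Rightarrow>\<^sub>0 nat, m)}. (if a = 0 then 1 else 0) * f b)"
      using finite_monomial_splits by (intro sum.mono_neutral_right) (auto split: if_splits)
    thus "(\<Sum>(a, b) \<in> {(a, b). a + b = m}. (if a = 0 then 1 else 0) * f b) = f m"
      by simp
  qed
  show "f * g * h = f * (g * h)"
  proof (transfer, rule ext)
    fix f g h :: "('a \<Rightarrow>\<^sub>0 nat) \<Rightarrow> 'b" and m
    let ?S = "\<lambda>m. {(a, b). a + b = (m :: 'a \<Rightarrow>\<^sub>0 nat)}"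
    have "(\<Sum>(a, b) \<in> ?S m. (\<Sum>(c, d) \<in> ?S a. f c * g d) * h b)
        = (\<Sum>p \<in> ?S m. \<Sum>q \<in> ?S (fst p). f (fst q) * g (snd q) * h (snd p))"
      by (simp add: split_def sum_distrib_right)
    also have "\<dots> = (\<Sum>(p, q) \<in> Sigma (?S m) (\<lambda>p. ?S (fst p)). f (fst q) * g (snd q) * h (snd p))"
      by (rule sum.Sigma) (auto simp: finite_monomial_splits)
    also have "\<dots> = (\<Sum>(p, q) \<in> Sigma (?S m) (\<lambda>p. ?S (snd p)). f (fst p) * (g (fst q) * h (snd q)))"
      by (rule sum.reindex_bij_witness[of _
            "\<lambda>(p, q). ((fst p + fst q, snd q), (fst p, fst q))"
            "\<lambda>(p, q). ((fst q, snd q + snd p), (snd q, snd p))"])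
        (auto simp: add.assoc mult.assoc)
    also have "\<dots> = (\<Sum>p \<in> ?S m. \<Sum>q \<in> ?S (snd p). f (fst p) * (g (fst q) * h (snd q)))"
      by (rule sum.Sigma[symmetric]) (auto simp: finite_monomial_splits)
    also have "\<dots> = (\<Sum>(a, b) \<in> ?S m. f a * (\<Sum>(c, d) \<in> ?S b. g c * h d))"
      by (simp add: split_def sum_distrib_left)
    finally show "(\<Sum>(a, b) \<in> ?S m. (\<Sum>(c, d) \<in> ?S a. f c * g d) * h b)
        = (\<Sum>(a, b) \<in> ?S m. f a * (\<Sum>(c, d) \<in> ?S b. g c * h d))" .
  qed
qed

end

definition gen_series :: "('v \<Rightarrow>\<^sub>0 nat) set \<Rightarrow> (('v \<Rightarrow>\<^sub>0 nat) \<Rightarrow> 'a) \<Rightarrow> ('v, 'a :: zero) mps"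
  \<comment> \<open>the formal sum \<open>\<Sum>\<mu>\<in>M. c \<mu> x\<^sup>\<mu>\<close>\<close>
  where "gen_series M c = mps_of (\<lambda>\<mu>. if \<mu> \<in> M then c \<mu> else 0)"

definition elem_sym :: "nat \<Rightarrow> ('v, 'a :: comm_ring_1) mps"
  where "elem_sym k = gen_series {\<Sum>i\<in>S. Poly_Mapping.single i 1 | S. finite S \<and> card S = k} (\<lambda>_. 1)"

definition elem_sym_partition :: "nat multiset \<Rightarrow> ('v, 'a :: comm_ring_1) mps"
  where "elem_sym_partition la = (\<Prod>k\<in>#la. elem_sym k)"

definition WComp :: "nat \<Rightarrow> ('v \<Rightarrow>\<^sub>0 nat) set"
  where "WComp n = {\<mu>. (\<Sum>i\<in>Poly_Mapping.keys \<mu>. Poly_Mapping.lookup \<mu> i) = n}"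


section \<open>The free Lie algebra with compatible brackets\<close>

text \<open>Nonassociative monomials: \<open>Br j s t\<close> stands for \<open>[s, t]\<^sub>j\<close>.\<close>

datatype (dead 'c, gens: 'a) bracketing =
  Gen 'a | Br 'c "('c, 'a) bracketing" "('c, 'a) bracketing"

primrec gens_list :: "('c, 'a) bracketing \<Rightarrow> 'a list" where
  "gens_list (Gen a) = [a]"
| "gens_list (Br j s t) = gens_list s @ gens_list t"

primrec count_br :: "('c, 'a) bracketing \<Rightarrow> 'c \<Rightarrow> nat" where
  "count_br (Gen a) i = 0"
| "count_br (Br j s t) i = (if j = i then 1 else 0) + count_br s i + count_br t i"

text \<open>
  The free algebra with one bilinear operation for each element of \<open>'c\<close>, on the generators \<open>'a\<close>,
  is the space \<open>('c, 'a) bracketing \<Rightarrow>\<^sub>0 'k\<close> of linear combinations of bracketings.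
\<close>

lift_definition fscale :: "'k \<Rightarrow> ('b \<Rightarrow>\<^sub>0 'k) \<Rightarrow> ('b \<Rightarrow>\<^sub>0 'k :: field)"
  is "\<lambda>c p t. c * p t"
  by (auto elim: finite_subset[rotated])

lift_definition fbracket :: "'c \<Rightarrow> (('c, 'a) bracketing \<Rightarrow>\<^sub>0 'k) \<Rightarrow> (('c, 'a) bracketing \<Rightarrow>\<^sub>0 'k)
    \<Rightarrow> (('c, 'a) bracketing \<Rightarrow>\<^sub>0 'k :: field)"
  is "\<lambda>i p q u. case u of Gen a \<Rightarrow> 0 | Br j s t \<Rightarrow> if j = i then p s * q t else 0"
proof -
  fix i :: 'c and p q :: "('c, 'a) bracketing \<Rightarrow> 'k"
  assume "finite {x. p x \<noteq> 0}" "finite {x. q x \<noteq> 0}"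
  hence "finite ((\<lambda>(s, t). Br i s t) ` ({x. p x \<noteq> 0} \<times> {x. q x \<noteq> 0}))" by simp
  thus "finite {u. (case u of Gen a \<Rightarrow> 0 | Br j s t \<Rightarrow> if j = i then p s * q t else 0) \<noteq> 0}"
    by (rule finite_subset[rotated]) (auto split: bracketing.split_asm if_split_asm)
qed

definition free_alg :: "'a set \<Rightarrow> (('c, 'a) bracketing \<Rightarrow>\<^sub>0 'k :: field) set"
  where "free_alg X = {p. \<forall>t\<in>Poly_Mapping.keys p. gens t \<subseteq> X}"

text \<open>The two-sided ideal of relations in the free algebra on \<open>X\<close>.\<close>

inductive_set lie_ideal :: "'a set \<Rightarrow> (('c, 'a) bracketing \<Rightarrow>\<^sub>0 'k :: field) set"
  for X :: "'a set"
where
  antisym: "\<lbrakk>x \<in> free_alg X; y \<in> free_alg X\<rbrakk> \<Longrightarrow> fbracket i x y + fbracket i y x \<in> lie_ideal X"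
| jacobi: "\<lbrakk>x \<in> free_alg X; y \<in> free_alg X; z \<in> free_alg X\<rbrakk> \<Longrightarrow>
    fbracket i x (fbracket i y z) + fbracket i z (fbracket i x y) + fbracket i y (fbracket i z x)
      \<in> lie_ideal X"
| compat: "\<lbrakk>x \<in> free_alg X; y \<in> free_alg X; z \<in> free_alg X; i \<noteq> j\<rbrakk> \<Longrightarrow>
    fbracket i x (fbracket j y z) + fbracket i z (fbracket j x y) + fbracket i y (fbracket j z x)
    + fbracket j x (fbracket i y z) + fbracket j z (fbracket i x y) + fbracket j y (fbracket i z x)
      \<in> lie_ideal X"
| zero: "0 \<in> lie_ideal X"
| add: "\<lbrakk>p \<in> lie_ideal X; q \<in> lie_ideal X\<rbrakk> \<Longrightarrow> p + q \<in> lie_ideal X"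
| scale: "p \<in> lie_ideal X \<Longrightarrow> fscale c p \<in> lie_ideal X"
| left: "\<lbrakk>p \<in> lie_ideal X; q \<in> free_alg X\<rbrakk> \<Longrightarrow> fbracket i p q \<in> lie_ideal X"
| right: "\<lbrakk>p \<in> lie_ideal X; q \<in> free_alg X\<rbrakk> \<Longrightarrow> fbracket i q p \<in> lie_ideal X"

lemma free_alg_UNIV [simp]: "p \<in> free_alg UNIV"
  by (simp add: free_alg_def)

lemma lookup_fscale: "Poly_Mapping.lookup (fscale c p) t = c * Poly_Mapping.lookup p t"
  by transfer simp

lemma lookup_fbracket: "Poly_Mapping.lookup (fbracket i p q) u =
    (case u of Gen a \<Rightarrow> 0
     | Br j s t \<Rightarrow> if j = i then Poly_Mapping.lookup p s * Poly_Mapping.lookup q t else 0)"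
  by (simp add: fbracket.rep_eq)

lemma fbracket_add_left: "fbracket i (p + p') q = fbracket i p q + fbracket i p' q"
proof (rule poly_mapping_eqI)
  fix u show "Poly_Mapping.lookup (fbracket i (p + p') q) u
      = Poly_Mapping.lookup (fbracket i p q + fbracket i p' q) u"
    unfolding lookup_fbracket lookup_add by (cases u) (simp_all add: distrib_right)
qed

lemma fbracket_add_right: "fbracket i p (q + q') = fbracket i p q + fbracket i p q'"
proof (rule poly_mapping_eqI)
  fix u show "Poly_Mapping.lookup (fbracket i p (q + q')) u
      = Poly_Mapping.lookup (fbracket i p q + fbracket i p q') u"
    unfolding lookup_fbracket lookup_add by (cases u) (simp_all add: distrib_left)
qed

lemma fbracket_diff_left: "fbracket i (p - p') q = fbracket i p q - fbracket i p' q"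
proof (rule poly_mapping_eqI)
  fix u show "Poly_Mapping.lookup (fbracket i (p - p') q) u
      = Poly_Mapping.lookup (fbracket i p q - fbracket i p' q) u"
    unfolding lookup_fbracket lookup_minus by (cases u) (simp_all add: left_diff_distrib)
qed

lemma fbracket_diff_right: "fbracket i p (q - q') = fbracket i p q - fbracket i p q'"
proof (rule poly_mapping_eqI)
  fix u show "Poly_Mapping.lookup (fbracket i p (q - q')) u
      = Poly_Mapping.lookup (fbracket i p q - fbracket i p q') u"
    unfolding lookup_fbracket lookup_minus by (cases u) (simp_all add: right_diff_distrib)
qed

lemma fscale_diff: "fscale c (p - q) = fscale c p - fscale c q"
  by (rule poly_mapping_eqI) (simp add: lookup_fscale lookup_minus algebra_simps)

lemma lie_ideal_uminus: "p \<in> lie_ideal X \<Longrightarrow> - p \<in> lie_ideal X"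
proof -
  assume "p \<in> lie_ideal X"
  moreover have "- p = fscale (-1) p"
    by (rule poly_mapping_eqI) (simp add: lookup_fscale)
  ultimately show ?thesis by (simp add: lie_ideal.scale)
qed

lemma lie_ideal_diff: "\<lbrakk>p \<in> lie_ideal X; q \<in> lie_ideal X\<rbrakk> \<Longrightarrow> p - q \<in> lie_ideal X"
  using lie_ideal.add[OF _ lie_ideal_uminus] by fastforce

definition lie_rel :: "(('c, 'a) bracketing \<Rightarrow>\<^sub>0 'k :: field) \<Rightarrow> (('c, 'a) bracketing \<Rightarrow>\<^sub>0 'k) \<Rightarrow> bool"
  where "lie_rel p q \<longleftrightarrow> p - q \<in> lie_ideal UNIV"

lemma equivp_lie_rel: "equivp lie_rel"
proof (rule equivpI)
  show "reflp lie_rel" by (simp add: reflp_def lie_rel_def lie_ideal.zero)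
  show "symp lie_rel"
    unfolding symp_def lie_rel_def using lie_ideal_uminus by fastforce
  show "transp lie_rel"
    unfolding transp_def lie_rel_def using lie_ideal.add by fastforce
qed

quotient_type (overloaded) ('c, 'a, 'k) free_lie =
  "('c, 'a) bracketing \<Rightarrow>\<^sub>0 'k :: field" / lie_rel
  by (rule equivp_lie_rel)

instantiation free_lie :: (type, type, field) ab_group_add
begin

lift_definition zero_free_lie :: "('a, 'b, 'c) free_lie" is 0 .
lift_definition plus_free_lie ::
  "('a, 'b, 'c) free_lie \<Rightarrow> ('a, 'b, 'c) free_lie \<Rightarrow> ('a, 'b, 'c) free_lie" is "(+)"
  unfolding lie_rel_def by (metis add_diff_add lie_ideal.add)
lift_definition minus_free_lie ::
  "('a, 'b, 'c) free_lie \<Rightarrow> ('a, 'b, 'c) free_lie \<Rightarrow> ('a, 'b, 'c) free_lie" is "(-)"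
proof -
  fix p p' q q' :: "('a, 'b) bracketing \<Rightarrow>\<^sub>0 'c"
  assume "lie_rel p p'" "lie_rel q q'"
  moreover have "p - q - (p' - q') = (p - p') - (q - q')" by simp
  ultimately show "lie_rel (p - q) (p' - q')"
    unfolding lie_rel_def by (metis lie_ideal_diff)
qed
lift_definition uminus_free_lie :: "('a, 'b, 'c) free_lie \<Rightarrow> ('a, 'b, 'c) free_lie" is uminus
proof -
  fix p q :: "('a, 'b) bracketing \<Rightarrow>\<^sub>0 'c"
  assume "lie_rel p q"
  moreover have "- p - - q = - (p - q)" by simp
  ultimately show "lie_rel (- p) (- q)"
    unfolding lie_rel_def by (metis lie_ideal_uminus)
qed

instance
proof
  fix x y z :: "('a, 'b, 'c) free_lie"
  have r: "lie_rel p p" for p :: "('a, 'b) bracketing \<Rightarrow>\<^sub>0 'c"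
    by (simp add: lie_rel_def lie_ideal.zero)
  show "x + y + z = x + (y + z)" by transfer (simp add: r add.assoc)
  show "x + y = y + x" by transfer (simp add: r add.commute)
  show "0 + x = x" by transfer (simp add: r)
  show "- x + x = 0" by transfer (simp add: r)
  show "x - y = x + - y" by transfer (simp add: r)
qed

end

lift_definition lie_scale :: "'k \<Rightarrow> ('c, 'a, 'k) free_lie \<Rightarrow> ('c, 'a, 'k :: field) free_lie" is fscale
  unfolding lie_rel_def by (metis fscale_diff lie_ideal.scale)

lift_definition lie_gen :: "'a \<Rightarrow> ('c, 'a, 'k :: field) free_lie"
  is "\<lambda>a. Poly_Mapping.single (Gen a) 1" .

lift_definition lie_bracket ::
  "'c \<Rightarrow> ('c, 'a, 'k) free_lie \<Rightarrow> ('c, 'a, 'k) free_lie \<Rightarrow> ('c, 'a, 'k :: field) free_lie" is fbracket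
proof -
  fix i :: 'c and p p' q q' :: "('c, 'a) bracketing \<Rightarrow>\<^sub>0 'k"
  assume "lie_rel p p'" "lie_rel q q'"
  moreover have "fbracket i p q - fbracket i p' q' = fbracket i (p - p') q + fbracket i p' (q - q')"
    by (simp add: fbracket_diff_left fbracket_diff_right)
  ultimately show "lie_rel (fbracket i p q) (fbracket i p' q')"
    unfolding lie_rel_def by (simp add: lie_ideal.add lie_ideal.left lie_ideal.right)
qed

global_interpretation free_lie: vector_space "lie_scale :: 'k :: field \<Rightarrow> ('c, 'a, 'k) free_lie \<Rightarrow> _"
  defines lie_span = free_lie.span and lie_dim = free_lie.dim
proof
  fix a b :: 'k and x y :: "('c, 'a, 'k) free_lie"
  have r: "lie_rel p q" if "p = q" for p q :: "('c, 'a) bracketing \<Rightarrow>\<^sub>0 'k"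
    using that by (simp add: lie_rel_def lie_ideal.zero)
  show "lie_scale a (x + y) = lie_scale a x + lie_scale a y"
    by transfer (intro r poly_mapping_eqI, simp add: lookup_fscale lookup_add algebra_simps)
  show "lie_scale (a + b) x = lie_scale a x + lie_scale b x"
    by transfer (intro r poly_mapping_eqI, simp add: lookup_fscale lookup_add algebra_simps)
  show "lie_scale a (lie_scale b x) = lie_scale (a * b) x"
    by transfer (intro r poly_mapping_eqI, simp add: lookup_fscale)
  show "lie_scale 1 x = x"
    by transfer (intro r poly_mapping_eqI, simp add: lookup_fscale)
qed

lemma lie_bracket_antisym: "lie_bracket i x y + lie_bracket i y x = 0"
  by transfer (simp add: lie_rel_def lie_ideal.antisym)

lemma lie_bracket_jacobi:
  "lie_bracket i x (lie_bracket i y z) + lie_bracket i z (lie_bracket i x y)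
    + lie_bracket i y (lie_bracket i z x) = 0"
  by transfer (simp add: lie_rel_def lie_ideal.jacobi)

lemma lie_bracket_compat: "i \<noteq> j \<Longrightarrow>
  lie_bracket i x (lie_bracket j y z) + lie_bracket i z (lie_bracket j x y)
    + lie_bracket i y (lie_bracket j z x)
    + lie_bracket j x (lie_bracket i y z) + lie_bracket j z (lie_bracket i x y)
    + lie_bracket j y (lie_bracket i z x) = 0"
  by transfer (simp add: lie_rel_def lie_ideal.compat)

text \<open>
  The type \<open>free_lie\<close> is the free algebra on all of \<open>'a\<close>. The free algebra on \<open>{1..n}\<close> is used below
  as the subalgebra of \<open>('c, nat, 'k) free_lie\<close> generated by \<open>{1..n}\<close>. This is justified by the next
  lemma: the other generators add no relation between elements of \<^term>\<open>free_alg X\<close>.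
\<close>

lemma lie_ideal_restrict:
  "lie_ideal UNIV \<inter> free_alg X = (lie_ideal X :: (('c, 'a) bracketing \<Rightarrow>\<^sub>0 'k :: field) set)"
proof -
  define \<rho> :: "(('c, 'a) bracketing \<Rightarrow>\<^sub>0 'k) \<Rightarrow> (('c, 'a) bracketing \<Rightarrow>\<^sub>0 'k)"
    where "\<rho> p = Poly_Mapping.mapp (\<lambda>t c. if gens t \<subseteq> X then c else 0) p"
    for p :: "('c, 'a) bracketing \<Rightarrow>\<^sub>0 'k"
  have lk: "Poly_Mapping.lookup (\<rho> p) t = (if gens t \<subseteq> X then Poly_Mapping.lookup p t else 0)" for p t
    by (simp add: \<rho>_def lookup_mapp when_def Poly_Mapping.in_keys_iff)
  have in_free: "\<rho> p \<in> free_alg X" for p :: "('c, 'a) bracketing \<Rightarrow>\<^sub>0 'k"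
    by (auto simp: free_alg_def Poly_Mapping.in_keys_iff lk split: if_splits)
  have br: "\<rho> (fbracket i p q) = fbracket i (\<rho> p) (\<rho> q)"
    for i and p q :: "('c, 'a) bracketing \<Rightarrow>\<^sub>0 'k"
    by (rule poly_mapping_eqI) (auto simp: lk lookup_fbracket split: bracketing.splits)
  have ad: "\<rho> (p + q) = \<rho> p + \<rho> q"
    for p q :: "('c, 'a) bracketing \<Rightarrow>\<^sub>0 'k"
    by (rule poly_mapping_eqI) (simp add: lk lookup_add)
  have sc: "\<rho> (fscale c p) = fscale c (\<rho> p)"
    for c and p :: "('c, 'a) bracketing \<Rightarrow>\<^sub>0 'k"
    by (rule poly_mapping_eqI) (simp add: lk lookup_fscale)
  have z: "\<rho> 0 = 0"
    by (rule poly_mapping_eqI) (simp add: lk)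
  have id: "\<rho> p = p" if "p \<in> free_alg X"
    for p :: "('c, 'a) bracketing \<Rightarrow>\<^sub>0 'k"
    using that by (intro poly_mapping_eqI) (auto simp: lk free_alg_def Poly_Mapping.in_keys_iff)
  have fa_add: "p + q \<in> free_alg X" if "p \<in> free_alg X" "q \<in> free_alg X"
    for p q :: "('c, 'a) bracketing \<Rightarrow>\<^sub>0 'k"
    using in_free[of "p + q"] that by (simp add: ad id)
  have fa_sc: "fscale c p \<in> free_alg X" if "p \<in> free_alg X"
    for c and p :: "('c, 'a) bracketing \<Rightarrow>\<^sub>0 'k"
    using in_free[of "fscale c p"] that by (simp add: sc id)
  have fa_br: "fbracket i p q \<in> free_alg X" if "p \<in> free_alg X" "q \<in> free_alg X"
    for i and p q :: "('c, 'a) bracketing \<Rightarrow>\<^sub>0 'k"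
    using in_free[of "fbracket i p q"] that by (simp add: br id)
  have fa_0: "(0 :: ('c, 'a) bracketing \<Rightarrow>\<^sub>0 'k) \<in> free_alg X"
    by (simp add: free_alg_def)
  have "\<rho> p \<in> lie_ideal X" if "p \<in> lie_ideal UNIV"
    for p :: "('c, 'a) bracketing \<Rightarrow>\<^sub>0 'k"
    using that by induction (simp_all add: ad sc br z in_free lie_ideal.intros)
  moreover have "p \<in> free_alg X" if "p \<in> lie_ideal X"
    for p :: "('c, 'a) bracketing \<Rightarrow>\<^sub>0 'k"
    using that by induction (simp_all add: fa_add fa_sc fa_br fa_0)
  moreover have "p \<in> lie_ideal UNIV" if "p \<in> lie_ideal X"
    for p :: "('c, 'a) bracketing \<Rightarrow>\<^sub>0 'k"
    using that by induction (simp_all add: lie_ideal.intros)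
  ultimately show ?thesis
    using id by fastforce
qed

primrec lie_eval :: "('c, 'a) bracketing \<Rightarrow> ('c, 'a, 'k :: field) free_lie" where
  "lie_eval (Gen a) = lie_gen a"
| "lie_eval (Br j s t) = lie_bracket j (lie_eval s) (lie_eval t)"

definition bracketed_perms :: "nat \<Rightarrow> ('c \<Rightarrow>\<^sub>0 nat) \<Rightarrow> ('c, nat) bracketing set"
  where "bracketed_perms n \<mu> =
    {t. distinct (gens_list t) \<and> set (gens_list t) = {1..n} \<and> (\<forall>j. count_br t j = Poly_Mapping.lookup \<mu> j)}"

definition Lie :: "nat \<Rightarrow> ('c \<Rightarrow>\<^sub>0 nat) \<Rightarrow> ('c, nat, 'k :: field) free_lie set"
  where "Lie n \<mu> = lie_span (lie_eval ` bracketed_perms n \<mu>)"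


section \<open>Normalized labeled binary trees and comb type\<close>

datatype 'a lbtree = Leaf 'a | Node "'a lbtree" "'a lbtree"

primrec leaves :: "'a lbtree \<Rightarrow> 'a list" where
  "leaves (Leaf a) = [a]"
| "leaves (Node l r) = leaves l @ leaves r"

primrec subtrees :: "'a lbtree \<Rightarrow> 'a lbtree set" where
  "subtrees (Leaf a) = {Leaf a}"
| "subtrees (Node l r) = insert (Node l r) (subtrees l \<union> subtrees r)"

definition normalized :: "nat lbtree \<Rightarrow> bool"
  where "normalized t \<longleftrightarrow> (\<forall>s\<in>subtrees t. hd (leaves s) = Min (set (leaves s)))"

definition Nor :: "nat \<Rightarrow> nat lbtree set"
  where "Nor n = {t. distinct (leaves t) \<and> set (leaves t) = {1..n} \<and> normalized t}"

text \<open>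
  A node is given by the path leading to it from the root, where \<^term>\<open>False\<close> means left and
  \<^term>\<open>True\<close> means right; the right child of \<open>p\<close> is \<open>p @ [True]\<close>.
\<close>

primrec inodes :: "'a lbtree \<Rightarrow> bool list set" where
  "inodes (Leaf a) = {}"
| "inodes (Node l r) = insert [] (Cons False ` inodes l \<union> Cons True ` inodes r)"

definition comb_closed :: "'a lbtree \<Rightarrow> bool list set set \<Rightarrow> bool"
  where "comb_closed t P \<longleftrightarrow> partition_on (inodes t) P \<and>
    (\<forall>x\<in>inodes t. x @ [True] \<in> inodes t \<longrightarrow> (\<exists>B\<in>P. x \<in> B \<and> x @ [True] \<in> B))"

definition comb_partition :: "'a lbtree \<Rightarrow> bool list set set"
  where "comb_partition t =
    (THE P. comb_closed t P \<and> (\<forall>Q. comb_closed t Q \<longrightarrow> refines (inodes t) P Q))"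

definition comb_type :: "'a lbtree \<Rightarrow> nat multiset"
  where "comb_type t = image_mset card (mset_set (comb_partition t))"

lemma ex1_comb_partition:
  "\<exists>!P. comb_closed t P \<and> (\<forall>Q. comb_closed t Q \<longrightarrow> refines (inodes t) P Q)"
proof -
  define E where "E = {(x, y). x \<in> inodes t \<and> y \<in> inodes t \<and>
    (\<forall>Q. comb_closed t Q \<longrightarrow> (\<exists>B\<in>Q. x \<in> B \<and> y \<in> B))}"
  have same: "B = C" if "comb_closed t Q" "B \<in> Q" "C \<in> Q" "x \<in> B" "x \<in> C" for Q B C x
    using that unfolding comb_closed_def partition_on_def disjoint_def by blast
  have cover: "\<exists>B\<in>Q. x \<in> B" if "comb_closed t Q" "x \<in> inodes t" for Q x
    using that unfolding comb_closed_def partition_on_def by blast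
  have "equiv (inodes t) E"
  proof (rule equivI)
    show "E \<subseteq> inodes t \<times> inodes t" by (auto simp: E_def)
    show "refl_on (inodes t) E" using cover by (auto simp: refl_on_def E_def)
    show "sym E" by (auto simp: sym_def E_def)
    show "trans E"
    proof (rule transI)
      fix x y z assume xy: "(x, y) \<in> E" and yz: "(y, z) \<in> E"
      have "\<exists>B\<in>Q. x \<in> B \<and> z \<in> B" if Q: "comb_closed t Q" for Q
      proof -
        obtain B where B: "B \<in> Q" "x \<in> B" "y \<in> B" using xy Q unfolding E_def by blast
        obtain C where C: "C \<in> Q" "y \<in> C" "z \<in> C" using yz Q unfolding E_def by blast
        show ?thesis using same[OF Q B(1) C(1) B(3) C(2)] B C by blast
      qed
      thus "(x, z) \<in> E" using xy yz by (simp add: E_def)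
    qed
  qed
  note eq = this
  let ?P = "inodes t // E"
  have part: "partition_on (inodes t) ?P"
    using eq by (rule partition_on_quotient)
  have "\<exists>B\<in>?P. x \<in> B \<and> x @ [True] \<in> B" if "x \<in> inodes t" "x @ [True] \<in> inodes t" for x
  proof
    have "(x, x @ [True]) \<in> E" using that by (auto simp: E_def comb_closed_def)
    thus "x \<in> E `` {x} \<and> x @ [True] \<in> E `` {x}"
      using equiv_class_self[OF eq that(1)] by simp
    show "E `` {x} \<in> ?P" using that by (rule_tac quotientI)
  qed
  hence closed: "comb_closed t ?P"
    using part by (simp add: comb_closed_def)
  have ref: "refines (inodes t) ?P Q" if Q: "comb_closed t Q" for Q
    unfolding refines_def
  proof (intro conjI ballI)
    show "partition_on (inodes t) Q" using Q by (simp add: comb_closed_def)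
    fix X assume "X \<in> ?P"
    then obtain x where x: "x \<in> inodes t" "X = E `` {x}" by (auto elim: quotientE)
    obtain B where B: "B \<in> Q" "x \<in> B" using cover[OF Q x(1)] by blast
    have "X \<subseteq> B"
    proof
      fix y assume "y \<in> X"
      hence "(x, y) \<in> E" by (simp add: x)
      then obtain C where "C \<in> Q" "x \<in> C" "y \<in> C" using Q by (auto simp: E_def)
      thus "y \<in> B" using same[OF Q] B by blast
    qed
    thus "\<exists>Y\<in>Q. X \<subseteq> Y" using B by blast
  qed (rule part)
  show ?thesis
  proof (rule ex1I[of _ ?P])
    show "comb_closed t ?P \<and> (\<forall>Q. comb_closed t Q \<longrightarrow> refines (inodes t) ?P Q)"
      using closed ref by blast
  next
    fix P assume "comb_closed t P \<and> (\<forall>Q. comb_closed t Q \<longrightarrow> refines (inodes t) P Q)"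
    thus "P = ?P" using closed ref refines_asym by blast
  qed
qed

lemma finite_Nor: "finite (Nor n)"
proof -
  have leaves_ne: "leaves t \<noteq> []" for t :: "nat lbtree"
    by (induction t) auto
  have fin: "finite {t :: nat lbtree. length (leaves t) \<le> k \<and> set (leaves t) \<subseteq> {1..n}}" for k
  proof (induction k)
    case 0
    thus ?case by (simp add: leaves_ne)
  next
    case (Suc k)
    let ?S = "\<lambda>k. {t :: nat lbtree. length (leaves t) \<le> k \<and> set (leaves t) \<subseteq> {1..n}}"
    have "t \<in> Leaf ` {1..n} \<union> case_prod Node ` (?S k \<times> ?S k)" if "t \<in> ?S (Suc k)" for t
    proof (cases t)
      case (Leaf a)
      thus ?thesis using that by auto
    next
      case (Node l r)
      have "Suc 0 \<le> length (leaves l)" "Suc 0 \<le> length (leaves r)"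
        using leaves_ne by (simp_all add: Suc_le_eq)
      moreover have "length (leaves l) + length (leaves r) \<le> Suc k"
        using that Node by simp
      ultimately have "length (leaves l) \<le> k" "length (leaves r) \<le> k"
        by linarith+
      with that Node have "l \<in> ?S k" "r \<in> ?S k" by auto
      thus ?thesis using Node by (auto intro!: rev_image_eqI[of "(l, r)"])
    qed
    hence "?S (Suc k) \<subseteq> Leaf ` {1..n} \<union> case_prod Node ` (?S k \<times> ?S k)"
      by blast
    thus ?case by (rule finite_subset) (use Suc.IH in auto)
  qed
  have "Nor n \<subseteq> {t. length (leaves t) \<le> n \<and> set (leaves t) \<subseteq> {1..n}}"
    by (auto simp: Nor_def simp flip: distinct_card)
  thus ?thesis using fin finite_subset by blast
qed

end

theory Submission
  imports Defs
begin

text \<open>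
  Call a bracketing a comb if no right child of a node has a colour at least that of the node. The
  relations of the compatible Lie algebra can be read as a rewriting system
  \<open>[a, [b, c]\<^sub>i]\<^sub>i \<rightarrow> [[a, b]\<^sub>i, c]\<^sub>i - [[a, c]\<^sub>i, b]\<^sub>i\<close> and, for \<open>i < j\<close>,
  \<open>[a, [b, c]\<^sub>j]\<^sub>i \<rightarrow> [[a, b]\<^sub>i, c]\<^sub>j + [[a, b]\<^sub>j, c]\<^sub>i - [[a, c]\<^sub>i, b]\<^sub>j - [[a, c]\<^sub>j, b]\<^sub>i - [a, [b, c]\<^sub>i]\<^sub>j\<close>
  whose normal forms are the combs. It is confluent, because all overlaps are resolved by one
  syzygy in degree four, so the normal form satisfies every instance of the relations, for arbitrary
  bracketings \<open>a\<close>, \<open>b\<close>, \<open>c\<close>. Antisymmetry is then built in by writing in each bracket the factor with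
  the smallest label first. Hence the combs whose underlying tree is normalized and whose colour
  content is \<open>\<mu>\<close> form a basis of \<open>Lie n \<mu>\<close>.

  In a comb the colours strictly decrease along each chain of right children, so the combs on a
  given tree correspond to the choice of a set of \<open>k\<close> colours for each block of size \<open>k\<close> of its comb
  partition. This is what the product of elementary symmetric functions counts.
\<close>

section \<open>Normal forms\<close>

primrec comb :: "('c::linorder, 'a) bracketing \<Rightarrow> bool" where
  "comb (Gen a) \<longleftrightarrow> True"
| "comb (Br i s t) \<longleftrightarrow> comb s \<and> comb t \<and> (case t of Gen a \<Rightarrow> True | Br j u v \<Rightarrow> j < i)"

primrec colours :: "('c, 'a) bracketing \<Rightarrow> 'c multiset" where
  "colours (Gen a) = {#}"
| "colours (Br i s t) = {#i#} + colours s + colours t"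

primrec labels :: "('c, 'a) bracketing \<Rightarrow> 'a multiset" where
  "labels (Gen a) = {#a#}"
| "labels (Br i s t) = labels s + labels t"

text \<open>Summed over all leaves, this is the number of right edges on the path from the
  root.\<close>

primrec right_weight :: "('c, 'a) bracketing \<Rightarrow> nat" where
  "right_weight (Gen a) = 0"
| "right_weight (Br i s t) = right_weight s + right_weight t + size (labels t)"

definition above :: "'c::linorder \<Rightarrow> ('c, 'a) bracketing \<Rightarrow> nat" where
  "above i t = size (filter_mset ((<) i) (colours t))"

lemma above_simps [simp]:
  "above i (Gen a) = 0"
  "above i (Br j s t) = (if i < j then 1 else 0) + above i s + above i t"
  by (simp_all add: above_def)

text \<open>An inversion statistic on pairs of a node and a node of its right subtree. It looks at
  the whole right subtree, so the contribution of the root depends only on the colours there and is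
  unaffected by rewriting inside.\<close>

primrec ascents :: "('c::linorder, 'a) bracketing \<Rightarrow> nat" where
  "ascents (Gen a) = 0"
| "ascents (Br i s t) = ascents s + ascents t + above i t"

text \<open>
  Rewriting \<open>a(bc)\<close> into terms of the shape \<open>(ab)c\<close> or \<open>(ac)b\<close> decreases the first component of the
  following measure; exchanging the colours of the two nodes of \<open>a(bc)\<close> preserves the first
  component and decreases the second.
\<close>

abbreviation tree_less :: "(('c::linorder, 'a) bracketing \<times> ('c, 'a) bracketing) set" where
  "tree_less \<equiv> measures [right_weight, ascents]"

section \<open>The rewriting step and its termination\<close>

fun root_red :: "'c::linorder \<Rightarrow> ('c, 'a) bracketing \<Rightarrow> ('c, 'a) bracketing \<Rightarrow> ('c, 'a) bracketing \<Rightarrow>\<^sub>0 int" where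
  "root_red i s (Gen a) = 0"
| "root_red i s (Br j u v) =
    (if i = j then frag_of (Br i (Br i s u) v) - frag_of (Br i (Br i s v) u)
     else frag_of (Br j (Br i s u) v) + frag_of (Br i (Br j s u) v)
        - frag_of (Br j (Br i s v) u) - frag_of (Br i (Br j s v) u) - frag_of (Br j s (Br i u v)))"

text \<open>An innermost strategy, left factor before right: the root is rewritten only when both
  factors are combs. This lets \<open>nf\<close> be computed factor by factor in
  \<open>nf_Br_left\<close> and \<open>nf_Br_right\<close>.\<close>

primrec red :: "('c::linorder, 'a) bracketing \<Rightarrow> ('c, 'a) bracketing \<Rightarrow>\<^sub>0 int" where
  "red (Gen a) = 0"
| "red (Br i s t) =
    (if \<not> comb s then frag_extend (\<lambda>x. frag_of (Br i x t)) (red s)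
     else if \<not> comb t then frag_extend (\<lambda>x. frag_of (Br i s x)) (red t)
     else root_red i s t)"

lemma size_labels_pos: "size (labels t) > 0"
  by (induction t) auto

lemma labels_nonempty [simp]: "labels t \<noteq> {#}"
  using size_labels_pos[of t] by auto

lemma above_mono: "i \<le> j \<Longrightarrow> above j t \<le> above i t"
  by (induction t) (auto intro!: add_mono)

lemma keys_frag_extend_frag_of:
  "Poly_Mapping.keys (frag_extend (\<lambda>x. frag_of (f x)) p) \<subseteq> f ` Poly_Mapping.keys p"
  using keys_frag_extend[of "\<lambda>x. frag_of (f x)" p] by auto

lemma keys_root_red:
  "w \<in> Poly_Mapping.keys (root_red i s (Br j u v)) \<Longrightarrow>
    w \<in> {Br j (Br i s u) v, Br i (Br j s u) v, Br j (Br i s v) u, Br i (Br j s v) u} \<or>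
    i \<noteq> j \<and> w = Br j s (Br i u v)"
  by (auto simp: in_keys_iff lookup_add lookup_minus split: if_splits)

lemma red_content:
  "w \<in> Poly_Mapping.keys (red t) \<Longrightarrow> colours w = colours t \<and> labels w = labels t"
proof (induction t arbitrary: w)
  case (Br i s t)
  consider "\<not> comb s" | "comb s" "\<not> comb t" | "comb s" "comb t" by blast
  thus ?case
  proof cases
    case 1
    with Br.prems keys_frag_extend_frag_of[of "\<lambda>x. Br i x t" "red s"] Br.IH(1)
    show ?thesis by fastforce
  next
    case 2
    with Br.prems keys_frag_extend_frag_of[of "\<lambda>x. Br i s x" "red t"] Br.IH(2)
    show ?thesis by fastforce
  next
    case 3
    show ?thesis
    proof (cases t)
      case (Br j u v)
      with 3 Br.prems keys_root_red[of w i s j u v]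
      show ?thesis by (auto simp: ac_simps)
    qed (use 3 Br.prems in auto)
  qed
qed simp

lemma red_less: "\<not> comb t \<Longrightarrow> w \<in> Poly_Mapping.keys (red t) \<Longrightarrow> (w, t) \<in> tree_less"
proof (induction t arbitrary: w)
  case (Br i s t)
  consider "\<not> comb s" | "comb s" "\<not> comb t" | "comb s" "comb t" by blast
  thus ?case
  proof cases
    case 1
    with Br.prems keys_frag_extend_frag_of[of "\<lambda>x. Br i x t" "red s"]
    obtain x where "x \<in> Poly_Mapping.keys (red s)" "w = Br i x t" by auto
    with Br.IH(1) 1 show ?thesis by force
  next
    case 2
    with Br.prems keys_frag_extend_frag_of[of "\<lambda>x. Br i s x" "red t"]
    obtain x where x: "x \<in> Poly_Mapping.keys (red t)" "w = Br i s x" by auto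
    \<comment> \<open>Rewriting inside \<open>t\<close> keeps its colours and labels, so the root
      contributes the same amount to both components.\<close>
    hence "above i x = above i t" "labels x = labels t"
      using red_content[OF x(1)] by (simp_all add: above_def)
    with x Br.IH(2) 2 show ?thesis by force
  next
    case 3
    \<comment> \<open>Reassociating lowers the right weight by the size of \<open>v\<close>. Moving
      the larger colour up removes the ascent between the two nodes, and \<open>above_mono\<close>
      controls the remaining pairs.\<close>
    then obtain j u v where t: "t = Br j u v" "i \<le> j"
      using Br.prems by (cases t) auto
    with 3 Br.prems keys_root_red[of w i s j u v]
      above_mono[of i j u] above_mono[of i j v] size_labels_pos[of u] size_labels_pos[of v]
    show ?thesis by auto
  qed
qed simp

text \<open>Tells the recursion below that \<open>nf\<close> is called only on the support of
  \<open>red t\<close>, where \<open>red_less\<close> applies.\<close>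

lemma frag_extend_cong [fundef_cong]:
  "p = q \<Longrightarrow> (\<And>x. x \<in> Poly_Mapping.keys q \<Longrightarrow> f x = g x) \<Longrightarrow> frag_extend f p = frag_extend g q"
  by (simp add: frag_extend_def)

function nf :: "('c::linorder, 'a) bracketing \<Rightarrow> ('c, 'a) bracketing \<Rightarrow>\<^sub>0 int" where
  "nf t = (if comb t then frag_of t else frag_extend nf (red t))"
  by auto
termination
  by (relation tree_less) (auto intro: red_less simp del: in_measures)

declare nf.simps [simp del]

lemma nf_comb: "comb t \<Longrightarrow> nf t = frag_of t"
  by (simp add: nf.simps)

lemma nf_red: "\<not> comb t \<Longrightarrow> nf t = frag_extend nf (red t)"
  by (simp add: nf.simps[of t])

lemma tree_less_induct [case_names less]:
  "(\<And>t. (\<And>s. (s, t) \<in> tree_less \<Longrightarrow> P s) \<Longrightarrow> P t) \<Longrightarrow> P t"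
  using wf_induct[OF wf_measures[of "[right_weight, ascents]"], of P t] by blast

lemma keys_nf:
  "w \<in> Poly_Mapping.keys (nf t) \<Longrightarrow> comb w \<and> colours w = colours t \<and> labels w = labels t"
proof (induction t arbitrary: w rule: tree_less_induct)
  case (less t)
  show ?case
  proof (cases "comb t")
    case False
    with less.prems keys_frag_extend[of nf "red t"] obtain x
      where "x \<in> Poly_Mapping.keys (red t)" "w \<in> Poly_Mapping.keys (nf x)"
      by (auto simp: nf_red)
    with less.IH[OF red_less[OF False]] red_content show ?thesis by metis
  qed (use less.prems in \<open>auto simp: nf_comb\<close>)
qed

section \<open>Linear extensions and bilinearity of the normal form\<close>

lemma frag_extend_frag_extend:
  "frag_extend f (frag_extend g p) = frag_extend (\<lambda>x. frag_extend f (g x)) p"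
  by (induction p rule: frag_induction[OF subset_UNIV]) (simp_all add: frag_extend_diff)

lemma frag_extend_diff_fun:
  "frag_extend (\<lambda>x. f x - g x) p = frag_extend f p - frag_extend g p"
  by (induction p rule: frag_induction[OF subset_UNIV]) (simp_all add: frag_extend_diff)

lemma frag_extend_add_fun:
  "frag_extend (\<lambda>x. f x + g x) p = frag_extend f p + frag_extend g p"
  by (induction p rule: frag_induction[OF subset_UNIV]) (simp_all add: frag_extend_diff)

lemma frag_extend_uminus_fun: "frag_extend (\<lambda>x. - f x) p = - frag_extend f p"
  using frag_extend_diff_fun[of "\<lambda>_. 0" f p] by (simp add: frag_extend_eq_0)

lemma frag_extend_swap:
  "frag_extend (\<lambda>x. frag_extend (f x) q) p = frag_extend (\<lambda>y. frag_extend (\<lambda>x. f x y) p) q"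
  by (induction p rule: frag_induction[OF subset_UNIV])
    (simp_all add: frag_extend_eq_0 frag_extend_diff frag_extend_diff_fun)

text \<open>\<open>red\<close> stays inside the left factor until that is a comb, so the two
  reductions run in parallel.\<close>

lemma nf_Br_left: "nf (Br i s t) = frag_extend (\<lambda>x. nf (Br i x t)) (nf s)"
proof (induction s rule: tree_less_induct)
  case (less s)
  show ?case
  proof (cases "comb s")
    case False
    have "nf (Br i s t) = frag_extend (\<lambda>x. nf (Br i x t)) (red s)"
      using False by (simp add: nf_red frag_extend_frag_extend)
    also have "\<dots> = frag_extend (\<lambda>y. frag_extend (\<lambda>x. nf (Br i x t)) (nf y)) (red s)"
      by (intro frag_extend_eq less red_less False)
    also have "\<dots> = frag_extend (\<lambda>x. nf (Br i x t)) (nf s)"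
      using False by (simp add: nf_red[of s] frag_extend_frag_extend)
    finally show ?thesis .
  qed (simp add: nf_comb)
qed

lemma nf_Br_right: "nf (Br i s t) = frag_extend (\<lambda>x. nf (Br i s x)) (nf t)"
proof -
  \<comment> \<open>\<open>red\<close> enters the right factor only once the left one is a comb. The
    general case follows by normalising \<open>s\<close> first and exchanging the two
    extensions.\<close>
  have *: "nf (Br i s t) = frag_extend (\<lambda>x. nf (Br i s x)) (nf t)" if "comb s" for s
  proof (induction t rule: tree_less_induct)
    case (less t)
    show ?case
    proof (cases "comb t")
      case False
      have "nf (Br i s t) = frag_extend (\<lambda>x. nf (Br i s x)) (red t)"
        using False that by (simp add: nf_red frag_extend_frag_extend)
      also have "\<dots> = frag_extend (\<lambda>y. frag_extend (\<lambda>x. nf (Br i s x)) (nf y)) (red t)"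
        by (intro frag_extend_eq less red_less False)
      also have "\<dots> = frag_extend (\<lambda>x. nf (Br i s x)) (nf t)"
        using False by (simp add: nf_red[of t] frag_extend_frag_extend)
      finally show ?thesis .
    qed (simp add: nf_comb)
  qed
  have "nf (Br i s t) = frag_extend (\<lambda>y. frag_extend (\<lambda>x. nf (Br i y x)) (nf t)) (nf s)"
    unfolding nf_Br_left[of i s t] by (intro frag_extend_eq *) (use keys_nf in blast)
  also have "\<dots> = frag_extend (\<lambda>x. frag_extend (\<lambda>y. nf (Br i y x)) (nf s)) (nf t)"
    by (rule frag_extend_swap)
  also have "\<dots> = frag_extend (\<lambda>x. nf (Br i s x)) (nf t)"
    by (simp flip: nf_Br_left)
  finally show ?thesis .
qed

section \<open>Confluence\<close>

text \<open>The normal form of \<open>a(bc) - (ab)c + (ac)b\<close>, summed over both ways of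
  placing the colours. For \<open>i = j\<close> it is twice the relation in a single
  bracket.\<close>

definition defect :: "'c::linorder \<Rightarrow> 'c \<Rightarrow> ('c, 'a) bracketing \<Rightarrow> ('c, 'a) bracketing \<Rightarrow> ('c, 'a) bracketing
    \<Rightarrow> ('c, 'a) bracketing \<Rightarrow>\<^sub>0 int" where
  "defect i j a b c = nf (Br i a (Br j b c)) + nf (Br j a (Br i b c))
     - nf (Br i (Br j a b) c) - nf (Br j (Br i a b) c)
     + nf (Br i (Br j a c) b) + nf (Br j (Br i a c) b)"

lemma defect_commute: "defect i j a b c = defect j i a b c"
  by (simp add: defect_def algebra_simps)

text \<open>Each argument enters only through its normal form, linearly. This and the next two
  lemmas reduce the vanishing of the defect to arguments that are combs.\<close>

lemma defect_left: "defect i j a b c = frag_extend (\<lambda>x. defect i j x b c) (nf a)"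
proof -
  have 1: "nf (Br i a t) = frag_extend (\<lambda>x. nf (Br i x t)) (nf a)" for i t
    by (rule nf_Br_left)
  have 2: "nf (Br i (Br j a t) u) = frag_extend (\<lambda>x. nf (Br i (Br j x t) u)) (nf a)" for i j t u
    by (simp add: nf_Br_left[of i "Br j _ t"] nf_Br_left[of j a] frag_extend_frag_extend)
  show ?thesis
    unfolding defect_def 2 1[of _ "Br _ b c"]
    by (simp add: frag_extend_diff_fun frag_extend_add_fun)
qed

lemma defect_middle: "defect i j a b c = frag_extend (\<lambda>x. defect i j a x c) (nf b)"
proof -
  have 1: "nf (Br i t b) = frag_extend (\<lambda>x. nf (Br i t x)) (nf b)" for i t
    by (rule nf_Br_right)
  have 2: "nf (Br i a (Br j b t)) = frag_extend (\<lambda>x. nf (Br i a (Br j x t))) (nf b)" for i j t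
    by (simp add: nf_Br_right[of i a "Br j _ t"] nf_Br_left[of j b] frag_extend_frag_extend)
  have 3: "nf (Br i (Br j a b) t) = frag_extend (\<lambda>x. nf (Br i (Br j a x) t)) (nf b)" for i j t
    by (simp add: nf_Br_left[of i "Br j a _" t] nf_Br_right[of j a b] frag_extend_frag_extend)
  show ?thesis
    unfolding defect_def 2 3 1[of _ "Br _ a c"]
    by (simp add: frag_extend_diff_fun frag_extend_add_fun)
qed

lemma defect_right: "defect i j a b c = frag_extend (\<lambda>x. defect i j a b x) (nf c)"
proof -
  have 1: "nf (Br i t c) = frag_extend (\<lambda>x. nf (Br i t x)) (nf c)" for i t
    by (rule nf_Br_right)
  have 2: "nf (Br i a (Br j t c)) = frag_extend (\<lambda>x. nf (Br i a (Br j t x))) (nf c)" for i j t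
    by (simp add: nf_Br_right[of i a "Br j t _"] nf_Br_right[of j t c] frag_extend_frag_extend)
  have 3: "nf (Br i (Br j a c) t) = frag_extend (\<lambda>x. nf (Br i (Br j a x) t)) (nf c)" for i j t
    by (simp add: nf_Br_left[of i "Br j a _" t] nf_Br_right[of j a c] frag_extend_frag_extend)
  show ?thesis
    unfolding defect_def 2 3 1[of _ "Br _ a b"]
    by (simp add: frag_extend_diff_fun frag_extend_add_fun)
qed

text \<open>A relation placed inside a larger product is a linear image of the defect; in this form
  it enters \<open>syzygy\<close>.\<close>

lemma nf_Br_left_defect:
  "nf (Br k (Br i a (Br j b c)) d) + nf (Br k (Br j a (Br i b c)) d)
     - nf (Br k (Br i (Br j a b) c) d) - nf (Br k (Br j (Br i a b) c) d)
     + nf (Br k (Br i (Br j a c) b) d) + nf (Br k (Br j (Br i a c) b) d)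
   = frag_extend (\<lambda>x. nf (Br k x d)) (defect i j a b c)"
  unfolding nf_Br_left[of k "Br _ _ _" d] defect_def by (simp add: frag_extend_diff frag_extend_add)

lemma nf_Br_right_defect:
  "nf (Br k d (Br i a (Br j b c))) + nf (Br k d (Br j a (Br i b c)))
     - nf (Br k d (Br i (Br j a b) c)) - nf (Br k d (Br j (Br i a b) c))
     + nf (Br k d (Br i (Br j a c) b)) + nf (Br k d (Br j (Br i a c) b))
   = frag_extend (\<lambda>x. nf (Br k d x)) (defect i j a b c)"
  unfolding nf_Br_right[of k d "Br _ _ _"] defect_def by (simp add: frag_extend_diff frag_extend_add)

text \<open>
  The three-colour polarisation of the degree four syzygy of the relation \<open>a(bc) = (ab)c - (ac)b\<close>.
  If \<open>i \<le> j \<le> k\<close>, all terms on the right are smaller than \<open>a i (b j (u k v))\<close> and hence vanish by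
  induction, and each of the last two terms on the left either is smaller as well or equals the first.
\<close>

lemma syzygy:
  "(defect i j a b (Br k u v) + defect i k a b (Br j u v) + defect j k a b (Br i u v))
   = (\<Sum>(p, q, r) \<in># {#(i, j, k), (i, k, j), (j, k, i)#}.
        frag_extend (\<lambda>x. nf (Br r a x)) (defect p q b u v)
      + defect p q a (Br r b u) v - defect p q a (Br r b v) u
      + frag_extend (\<lambda>x. nf (Br r x v)) (defect p q a b u)
      - frag_extend (\<lambda>x. nf (Br r x u)) (defect p q a b v)
      - defect p q (Br r a v) b u + defect p q (Br r a u) b v
      - defect p q (Br r a b) u v + frag_extend (\<lambda>x. nf (Br r x b)) (defect p q a u v))"
  unfolding nf_Br_left_defect[symmetric] nf_Br_right_defect[symmetric]
  by (simp add: defect_def algebra_simps)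

text \<open>
  Coinciding colours only yield a multiple of the relation; this is why normal forms have integer
  coefficients and are mapped to the field at the end.
\<close>

lemma frag_double_eq_0:
  fixes p :: "'b \<Rightarrow>\<^sub>0 int"
  shows "p + p = 0 \<Longrightarrow> p = 0" "p + p + p = 0 \<Longrightarrow> p = 0"
  by (auto simp: poly_mapping_eq_iff fun_eq_iff lookup_add)

lemma nf_root_red:
  assumes "comb s" "comb (Br j u v)" "i \<le> j"
  shows "nf (Br i s (Br j u v)) = frag_extend nf (root_red i s (Br j u v))"
  using assms by (auto simp: nf_red)

text \<open>With combs as factors the first rewriting step happens at the root, and that step is the
  relation itself.\<close>

lemma defect_comb:
  assumes "comb a" "comb (Br j b c)" "i \<le> j"
  shows "defect i j a b c = 0"
  using nf_root_red[OF assms]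
  by (cases "i = j") (simp_all add: defect_def frag_extend_diff frag_extend_add)

section \<open>Vanishing of the defect\<close>

lemma nf_keys_less:
  "\<not> comb t \<Longrightarrow> w \<in> Poly_Mapping.keys (nf t) \<Longrightarrow> (w, t) \<in> tree_less"
proof (induction t rule: tree_less_induct)
  case (less t)
  with keys_frag_extend[of nf "red t"] obtain x
    where x: "x \<in> Poly_Mapping.keys (red t)" "w \<in> Poly_Mapping.keys (nf x)"
    by (auto simp: nf_red)
  hence xt: "(x, t) \<in> tree_less"
    using red_less less.prems by blast
  show ?case
  proof (cases "comb x")
    case True
    thus ?thesis using x xt by (simp add: nf_comb del: in_measures)
  next
    case False
    thus ?thesis using less.IH[OF xt False x(2)] xt by auto
  qed
qed

text \<open>Well-founded induction on \<open>a(bc)\<close> with the smaller colour at the root. An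
  argument that is not a comb is replaced by its smaller normal form; a true overlap is resolved by
  \<open>syzygy\<close>.\<close>

lemma defect_eq_0: "i \<le> j \<Longrightarrow> defect i j a b c = 0"
proof (induction "Br i a (Br j b c)" arbitrary: i j a b c rule: tree_less_induct)
  case less
  \<comment> \<open>The defect is symmetric in its colours, so each instance is represented by the
    bracketing with the smaller colour at the root.\<close>
  have IH: "defect p q x y z = 0"
    if "(Br (min p q) x (Br (max p q) y z), Br i a (Br j b c)) \<in> tree_less" for p q x y z
    using less.hyps[OF that] by (cases "p \<le> q") (auto simp: defect_commute[of p q])
  have "frag_extend f (defect p q x y z) = 0"
    if "(Br (min p q) x (Br (max p q) y z), Br i a (Br j b c)) \<in> tree_less"
    for p q x y z and f :: "('a, 'b) bracketing \<Rightarrow> ('a, 'b) bracketing \<Rightarrow>\<^sub>0 int"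
    using IH[OF that] by simp
  note IHe = this
  consider "\<not> comb a" | "\<not> comb b" | "\<not> comb c" | "comb a" "comb b" "comb c" by blast
  thus ?case
  proof cases
    case 4
    show ?thesis
    proof (cases "comb (Br j b c)")
      case False
      \<comment> \<open>The critical overlap: \<open>a(b(uv))\<close> can be rewritten at its root
        and also in \<open>b(uv)\<close>.\<close>
      then obtain k u v where c: "c = Br k u v" and jk: "j \<le> k"
        using 4 by (cases c) auto
      have pos: "0 < size (labels u)" "0 < size (labels v)" "0 < size (labels b)" "0 < size (labels a)"
        by (rule size_labels_pos)+
      have "defect i j a b (Br k u v) + defect i k a b (Br j u v) + defect j k a b (Br i u v) = 0"
        unfolding syzygy using pos less.prems jk by (simp add: IH IHe c)
      \<comment> \<open>A nontrivial permutation of the colours keeps the right weight and lowers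
        \<open>ascents\<close>, so induction applies.\<close>
      moreover have "defect i k a b (Br j u v) = 0" if "j \<noteq> k"
      proof (rule IH)
        have "j < k" "i < k" using that jk less.prems by auto
        thus "(Br (min i k) a (Br (max i k) b (Br j u v)), Br i a (Br j b c)) \<in> tree_less"
          using above_mono[OF jk, of b] above_mono[OF jk, of u] above_mono[OF jk, of v]
          by (auto simp: c)
      qed
      moreover have "defect j k a b (Br i u v) = 0" if "i \<noteq> k"
      proof (rule IH)
        have "i < k" using that jk less.prems by auto
        moreover have "\<not> j < i" "\<not> k < j" "\<not> k < i"
          using jk less.prems by auto
        moreover have "above j b \<le> above i b" "above k u \<le> above i u"
            "above k b \<le> above j b" "above k v \<le> above i v"
          using jk less.prems by (auto intro: above_mono)
        ultimately show "(Br (min j k) a (Br (max j k) b (Br i u v)), Br i a (Br j b c)) \<in> tree_less"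
          using jk less.prems by (cases "i = j"; cases "j = k") (simp_all add: c)
      qed
      moreover have "i = j" if "i = k"
        using that jk less.prems by simp
      \<comment> \<open>What remains is the defect taken once, twice or three times, according to
        how many of the three summands coincide; integer coefficients allow the factor to be
        cancelled.\<close>
      ultimately show ?thesis
        unfolding c by (cases "i = k"; cases "j = k") (auto intro: frag_double_eq_0)
    qed (use 4 less.prems in \<open>simp add: defect_comb\<close>)
  next
    case 1
    have "defect i j x b c = 0" if "x \<in> Poly_Mapping.keys (nf a)" for x
      by (rule IH) (use nf_keys_less[OF 1 that] less.prems in auto)
    thus ?thesis
      unfolding defect_left[of i j a] by (intro frag_extend_eq_0)
  next
    case 2
    have "defect i j a x c = 0" if "x \<in> Poly_Mapping.keys (nf b)" for x
      by (rule IH) (use nf_keys_less[OF 2 that] keys_nf[OF that] less.prems in \<open>auto simp: above_def\<close>)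
    thus ?thesis
      unfolding defect_middle[of i j a b] by (intro frag_extend_eq_0)
  next
    case 3
    have "defect i j a b x = 0" if "x \<in> Poly_Mapping.keys (nf c)" for x
      by (rule IH) (use nf_keys_less[OF 3 that] keys_nf[OF that] less.prems in \<open>auto simp: above_def\<close>)
    thus ?thesis
      unfolding defect_right[of i j a b c] by (intro frag_extend_eq_0)
  qed
qed

section \<open>Linear independence of combs\<close>

definition least_label :: "('c, 'a::linorder) bracketing \<Rightarrow> 'a" where
  "least_label t = Min (set_mset (labels t))"

lemma least_label_simps [simp]:
  "least_label (Gen a) = a"
  "least_label (Br i s t) = min (least_label s) (least_label t)"
  by (simp_all add: least_label_def Min_Un)

lemma least_label_in: "least_label t \<in># labels t"
  unfolding least_label_def by (rule Min_in) simp_all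

abbreviation disjoint_labels :: "('c, 'a) bracketing \<Rightarrow> ('c, 'a) bracketing \<Rightarrow> bool" where
  "disjoint_labels s t \<equiv> set_mset (labels s) \<inter> set_mset (labels t) = {}"

lemma least_label_neq: "disjoint_labels s t \<Longrightarrow> least_label s \<noteq> least_label t"
  using least_label_in[of s] least_label_in[of t] by auto

text \<open>
  Only multilinear elements matter, so brackets of terms with a common label are set to zero.
\<close>

definition nf_bracket :: "'c::linorder \<Rightarrow> ('c, 'a::linorder) bracketing \<Rightarrow> ('c, 'a) bracketing
    \<Rightarrow> ('c, 'a) bracketing \<Rightarrow>\<^sub>0 int" where
  "nf_bracket i s t =
    (if \<not> disjoint_labels s t then 0
     else if least_label s < least_label t then nf (Br i s t) else - nf (Br i t s))"

lemma nf_bracket_antisym: "nf_bracket i s t + nf_bracket i t s = 0"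
  using least_label_neq[of s t] by (auto simp: nf_bracket_def Int_commute)

text \<open>Which case of \<open>nf_bracket\<close> applies depends on the labels only, and normal
  forms preserve these.\<close>

lemma nf_bracket_nf_right: "frag_extend (nf_bracket i s) (nf t) = nf_bracket i s t"
proof -
  have "frag_extend (nf_bracket i s) (nf t) = frag_extend (\<lambda>w.
      if \<not> disjoint_labels s t then 0
      else if least_label s < least_label t then nf (Br i s w) else - nf (Br i w s)) (nf t)"
  proof (rule frag_extend_eq)
    fix w assume "w \<in> Poly_Mapping.keys (nf t)"
    hence "labels w = labels t" using keys_nf by blast
    thus "nf_bracket i s w = (if \<not> disjoint_labels s t then 0
        else if least_label s < least_label t then nf (Br i s w) else - nf (Br i w s))"
      by (simp only: nf_bracket_def least_label_def)
  qed
  thus ?thesis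
    by (auto simp: nf_bracket_def nf_Br_right[of i s t] nf_Br_left[of i t s] frag_extend_eq_0
        frag_extend_uminus_fun)
qed

lemma nf_bracket_nf_bracket:
  assumes "disjoint_labels y z"
  shows "frag_extend (nf_bracket i x) (nf_bracket j y z)
    = (if least_label y < least_label z then nf_bracket i x (Br j y z) else - nf_bracket i x (Br j z y))"
  using assms by (subst nf_bracket_def) (simp add: nf_bracket_nf_right frag_extend_minus)

lemma frag_extend_nf_bracket_eq_0:
  assumes "\<not> (disjoint_labels x y \<and> disjoint_labels x z \<and> disjoint_labels y z)"
  shows "frag_extend (nf_bracket i x) (nf_bracket j y z) = 0"
proof (cases "disjoint_labels y z")
  case True
  with assms have "\<not> disjoint_labels x (Br j y z)" "\<not> disjoint_labels x (Br j z y)" by auto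
  thus ?thesis
    unfolding nf_bracket_nf_bracket[OF True] nf_bracket_def[of i] by simp
qed (simp add: nf_bracket_def)

definition jacobiator :: "'c::linorder \<Rightarrow> 'c \<Rightarrow> ('c, 'a::linorder) bracketing \<Rightarrow> ('c, 'a) bracketing
    \<Rightarrow> ('c, 'a) bracketing \<Rightarrow> ('c, 'a) bracketing \<Rightarrow>\<^sub>0 int" where
  "jacobiator i j x y z =
     frag_extend (nf_bracket i x) (nf_bracket j y z) + frag_extend (nf_bracket i z) (nf_bracket j x y)
     + frag_extend (nf_bracket i y) (nf_bracket j z x)"

lemma jacobiator_rotate: "jacobiator i j x y z = jacobiator i j y z x"
  by (simp add: jacobiator_def add_ac)

text \<open>With \<open>jacobiator_rotate\<close>, this allows the arguments to be sorted by least
  label at the cost of a sign.\<close>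

lemma jacobiator_swap: "jacobiator i j x z y = - jacobiator i j x y z"
proof -
  have "nf_bracket j s t = - nf_bracket j t s" for s t :: "('a, 'b) bracketing"
    using nf_bracket_antisym[of j s t] by (simp add: eq_neg_iff_add_eq_0)
  hence "frag_extend (nf_bracket i r) (nf_bracket j s t) = - frag_extend (nf_bracket i r) (nf_bracket j t s)"
    for r s t :: "('a, 'b) bracketing"
    using frag_extend_minus by metis
  from this[of x z y] this[of y x z] this[of z y x] show ?thesis
    by (simp add: jacobiator_def)
qed

text \<open>In sorted order the signs turn the cyclic sum into \<open>a(bc) - (ab)c + (ac)b\<close>;
  adding the version with exchanged colours gives \<open>defect\<close>.\<close>

lemma jacobiator_sorted:
  assumes d: "disjoint_labels x y" "disjoint_labels x z" "disjoint_labels y z"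
    and less: "least_label x < least_label y" "least_label y < least_label z"
  shows "jacobiator i j x y z = nf (Br i x (Br j y z)) - nf (Br i (Br j x y) z) + nf (Br i (Br j x z) y)"
proof -
  have 1: "frag_extend (nf_bracket i x) (nf_bracket j y z) = nf (Br i x (Br j y z))"
    using d less by (subst nf_bracket_nf_bracket) (auto simp: nf_bracket_def)
  have 2: "frag_extend (nf_bracket i z) (nf_bracket j x y) = - nf (Br i (Br j x y) z)"
    using d less by (subst nf_bracket_nf_bracket) (auto simp: nf_bracket_def)
  have 3: "frag_extend (nf_bracket i y) (nf_bracket j z x) = nf (Br i (Br j x z) y)"
    using d less by (subst nf_bracket_nf_bracket) (auto simp: nf_bracket_def)
  show ?thesis
    unfolding jacobiator_def 1 2 3 by simp
qed

lemma jacobiator_eq_0: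
  assumes "\<not> (disjoint_labels x y \<and> disjoint_labels x z \<and> disjoint_labels y z)"
  shows "jacobiator i j x y z = 0"
proof -
  have "frag_extend (nf_bracket i x) (nf_bracket j y z) = 0"
    "frag_extend (nf_bracket i z) (nf_bracket j x y) = 0"
    "frag_extend (nf_bracket i y) (nf_bracket j z x) = 0"
    by (rule frag_extend_nf_bracket_eq_0, use assms in blast)+
  thus ?thesis by (simp add: jacobiator_def)
qed

lemma nf_bracket_compat:
  fixes x y z :: "('c::linorder, 'a::linorder) bracketing"
  shows "jacobiator i j x y z + jacobiator j i x y z = 0"
proof (cases "disjoint_labels x y \<and> disjoint_labels x z \<and> disjoint_labels y z")
  case True
  hence d: "disjoint_labels x y" "disjoint_labels x z" "disjoint_labels y z"
    "disjoint_labels y x" "disjoint_labels z x" "disjoint_labels z y" by blast+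
  \<comment> \<open>\<open>P\<close> is preserved by rotation and by exchanging the last two
    arguments, hence by all permutations; the six cases below start from the sorted order.\<close>
  define P where "P a b c \<longleftrightarrow> jacobiator i j a b c + jacobiator j i a b c = 0" for a b c :: "('c, 'a) bracketing"
  have rot: "P b c a" if "P a b c" for a b c
    using that unfolding P_def jacobiator_rotate[of _ _ a b c] .
  have swap: "P a c b" if "P a b c" for a b c
    using that unfolding P_def jacobiator_swap[of i j a c b] jacobiator_swap[of j i a c b]
    by (metis minus_add_distrib neg_equal_0_iff_equal)
  have sorted: "P a b c" if "disjoint_labels a b" "disjoint_labels a c" "disjoint_labels b c"
      "least_label a < least_label b" "least_label b < least_label c" for a b c
  proof -
    have "defect i j a b c = 0"
      using defect_eq_0[of i j a b c] defect_eq_0[of j i a b c] defect_commute[of i j a b c]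
      by (cases "i \<le> j") simp_all
    thus ?thesis
      unfolding P_def jacobiator_sorted[OF that] defect_def by (simp add: algebra_simps)
  qed
  have "least_label x < least_label y \<or> least_label y < least_label x"
    "least_label x < least_label z \<or> least_label z < least_label x"
    "least_label y < least_label z \<or> least_label z < least_label y"
    using least_label_neq[OF d(1)] least_label_neq[OF d(2)] least_label_neq[OF d(3)]
    by (simp_all only: neq_iff)
  note ne = this
  consider "least_label x < least_label y" "least_label y < least_label z"
    | "least_label x < least_label z" "least_label z < least_label y"
    | "least_label y < least_label x" "least_label x < least_label z"
    | "least_label y < least_label z" "least_label z < least_label x"
    | "least_label z < least_label x" "least_label x < least_label y"
    | "least_label z < least_label y" "least_label y < least_label x"
    using ne by blast
  hence "P x y z"
  proof cases
    case 1
    show ?thesis by (rule sorted) (use 1 d in simp_all)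
  next
    case 2
    show ?thesis by (rule swap[OF sorted]) (use 2 d in simp_all)
  next
    case 3
    show ?thesis by (rule rot[OF swap[OF rot[OF rot[OF sorted]]]]) (use 3 d in simp_all)
  next
    case 4
    show ?thesis by (rule rot[OF rot[OF sorted]]) (use 4 d in simp_all)
  next
    case 5
    show ?thesis by (rule rot[OF sorted]) (use 5 d in simp_all)
  next
    case 6
    show ?thesis by (rule rot[OF swap[OF sorted]]) (use 6 d in simp_all)
  qed
  thus ?thesis by (simp add: P_def)
next
  case False
  thus ?thesis using jacobiator_eq_0[of x y z] by simp
qed

lemma nf_bracket_jacobi: "jacobiator i i x y z = 0"
  using nf_bracket_compat[of i i x y z] by (rule frag_double_eq_0(1))

section \<open>Linear extension over the field and change of coefficients\<close>

definition lin :: "('b \<Rightarrow> 'd \<Rightarrow>\<^sub>0 'k) \<Rightarrow> ('b \<Rightarrow>\<^sub>0 'k) \<Rightarrow> 'd \<Rightarrow>\<^sub>0 'k::field" where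
  "lin f p = (\<Sum>x\<in>Poly_Mapping.keys p. fscale (Poly_Mapping.lookup p x) (f x))"

lemma lookup_lin:
  "Poly_Mapping.lookup (lin f p) y
    = (\<Sum>x\<in>Poly_Mapping.keys p. Poly_Mapping.lookup p x * Poly_Mapping.lookup (f x) y)"
  by (simp add: lin_def lookup_sum lookup_fscale)

lemma lookup_lin_superset:
  assumes "finite S" "Poly_Mapping.keys p \<subseteq> S"
  shows "Poly_Mapping.lookup (lin f p) y = (\<Sum>x\<in>S. Poly_Mapping.lookup p x * Poly_Mapping.lookup (f x) y)"
  unfolding lookup_lin using assms by (intro sum.mono_neutral_left) (auto simp: in_keys_iff)

lemma lin_add: "lin f (p + q) = lin f p + lin f q"
proof (rule poly_mapping_eqI)
  fix y
  let ?S = "Poly_Mapping.keys p \<union> Poly_Mapping.keys q"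
  have "Poly_Mapping.keys (p + q) \<subseteq> ?S" by (rule Poly_Mapping.keys_add)
  thus "Poly_Mapping.lookup (lin f (p + q)) y = Poly_Mapping.lookup (lin f p + lin f q) y"
    by (simp add: lookup_add lookup_lin_superset[of ?S] distrib_right sum.distrib)
qed

lemma lin_fscale: "lin f (fscale c p) = fscale c (lin f p)"
proof (rule poly_mapping_eqI)
  fix y
  have "Poly_Mapping.keys (fscale c p) \<subseteq> Poly_Mapping.keys p"
    by (auto simp: in_keys_iff lookup_fscale)
  thus "Poly_Mapping.lookup (lin f (fscale c p)) y = Poly_Mapping.lookup (fscale c (lin f p)) y"
    by (simp add: lookup_fscale lookup_lin_superset[of "Poly_Mapping.keys p"] sum_distrib_left mult.assoc)
qed

lemma lin_0 [simp]: "lin f 0 = 0"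
  by (simp add: lin_def)

lemma lin_single: "lin f (Poly_Mapping.single x c) = fscale c (f x)"
  by (cases "c = 0") (auto simp: lin_def intro!: poly_mapping_eqI simp: lookup_fscale)

lemma fscale_1 [simp]: "fscale 1 p = p"
  by (rule poly_mapping_eqI) (simp add: lookup_fscale)

lemma fscale_0 [simp]: "fscale c 0 = 0"
  by (rule poly_mapping_eqI) (simp add: lookup_fscale)

lemma lin_add_fun: "lin (\<lambda>x. f x + g x) p = lin f p + lin g p"
  by (rule poly_mapping_eqI) (simp add: lookup_lin lookup_add distrib_left sum.distrib)

lemma lin_eq_0: "(\<And>x. f x = 0) \<Longrightarrow> lin f p = 0"
  by (simp add: lin_def)

lemma lin_fscale_fun: "lin (\<lambda>x. fscale c (f x)) p = fscale c (lin f p)"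
  by (rule poly_mapping_eqI) (simp add: lookup_lin lookup_fscale sum_distrib_left mult.left_commute)

lemma lin_sum: "lin f (sum h A) = (\<Sum>x\<in>A. lin f (h x))"
  by (induction A rule: infinite_finite_induct) (simp_all add: lin_add)

lemma lin_lin: "lin f (lin g p) = lin (\<lambda>x. lin f (g x)) p"
  by (simp add: lin_def[of g] lin_def[of "\<lambda>x. lin f (g x)"] lin_fscale lin_sum)

lemma lin_swap: "lin (\<lambda>x. lin (f x) q) p = lin (\<lambda>y. lin (\<lambda>x. f x y) p) q"
  by (rule poly_mapping_eqI)
    (simp add: lookup_lin sum_distrib_left sum.swap[of _ "Poly_Mapping.keys q"] mult.left_commute)

lemma poly_mapping_add_induct [case_names add single]:
  assumes "\<And>p q. P p \<Longrightarrow> P q \<Longrightarrow> P (p + q)" "\<And>x c. P (Poly_Mapping.single x c)"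
  shows "P (p :: 'b \<Rightarrow>\<^sub>0 'k::comm_monoid_add)"
proof -
  have "P (\<Sum>x\<in>A. Poly_Mapping.single x (Poly_Mapping.lookup p x))" for A
  proof (induction A rule: infinite_finite_induct)
    case empty
    \<comment> \<open>Zero is a monomial with coefficient 0, at an arbitrary position.\<close>
    show ?case using assms(2)[of undefined 0] by simp
  next
    case (infinite A)
    show ?case using assms(2)[of undefined 0] infinite by simp
  qed (use assms in simp_all)
  moreover have "p = (\<Sum>x\<in>Poly_Mapping.keys p. Poly_Mapping.single x (Poly_Mapping.lookup p x))"
    by (rule poly_mapping_eqI)
      (auto simp: lookup_sum lookup_single when_def in_keys_iff sum.If_cases)
  ultimately show ?thesis by metis
qed

text \<open>Carries the normal forms, computed over the integers where multiples can be cancelled,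
  to a field of any characteristic.\<close>

lift_definition of_frag :: "('b \<Rightarrow>\<^sub>0 int) \<Rightarrow> 'b \<Rightarrow>\<^sub>0 'k::field" is "\<lambda>p x. of_int (p x)"
  by (auto elim: finite_subset[rotated])

lemma lookup_of_frag: "Poly_Mapping.lookup (of_frag p) x = of_int (Poly_Mapping.lookup p x)"
  by transfer simp

lemma of_frag_0 [simp]: "of_frag 0 = 0"
  by (rule poly_mapping_eqI) (simp add: lookup_of_frag)

lemma of_frag_add: "of_frag (p + q) = of_frag p + of_frag q"
  by (rule poly_mapping_eqI) (simp add: lookup_of_frag lookup_add)

lemma of_frag_frag_of: "of_frag (frag_of x) = Poly_Mapping.single x 1"
  by (rule poly_mapping_eqI) (simp add: lookup_of_frag lookup_single when_def)

lemma of_frag_frag_extend: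
  "of_frag (frag_extend f p) = (lin (\<lambda>x. of_frag (f x)) (of_frag p) :: _ \<Rightarrow>\<^sub>0 'k::field)"
proof (rule poly_mapping_eqI)
  fix y
  \<comment> \<open>The support may shrink in positive characteristic, so both sums are taken over
    the integral support.\<close>
  have "Poly_Mapping.keys (of_frag p :: _ \<Rightarrow>\<^sub>0 'k) \<subseteq> Poly_Mapping.keys p"
    by (auto simp: in_keys_iff lookup_of_frag)
  thus "Poly_Mapping.lookup (of_frag (frag_extend f p)) y
      = Poly_Mapping.lookup (lin (\<lambda>x. of_frag (f x)) (of_frag p) :: _ \<Rightarrow>\<^sub>0 'k) y"
    by (simp add: lookup_lin_superset[of "Poly_Mapping.keys p"] lookup_of_frag frag_extend_def lookup_sum)
qed

section \<open>Comb coordinates on the free Lie algebra\<close>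

definition comb_bracket :: "'c::linorder \<Rightarrow> (('c, 'a::linorder) bracketing \<Rightarrow>\<^sub>0 'k) \<Rightarrow> (('c, 'a) bracketing \<Rightarrow>\<^sub>0 'k)
    \<Rightarrow> ('c, 'a) bracketing \<Rightarrow>\<^sub>0 'k::field" where
  "comb_bracket i p q = lin (\<lambda>x. lin (\<lambda>y. of_frag (nf_bracket i x y)) q) p"

lemma comb_bracket_antisym: "comb_bracket i p q + comb_bracket i q p = 0"
  unfolding comb_bracket_def lin_swap[of _ p q]
  by (simp flip: lin_add_fun of_frag_add add: nf_bracket_antisym lin_eq_0)

lemma comb_bracket_comb_bracket:
  "comb_bracket i p (comb_bracket j q r) =
    lin (\<lambda>x. lin (\<lambda>y. lin (\<lambda>z. of_frag (frag_extend (nf_bracket i x) (nf_bracket j y z))) r) q) p"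
  by (simp add: comb_bracket_def lin_lin of_frag_frag_extend)

lemma comb_bracket_jacobiator:
  "comb_bracket i p (comb_bracket j q r) + comb_bracket i r (comb_bracket j p q)
     + comb_bracket i q (comb_bracket j r p)
   = lin (\<lambda>x. lin (\<lambda>y. lin (\<lambda>z. of_frag (jacobiator i j x y z)) r) q) p"
proof -
  have "comb_bracket i r (comb_bracket j p q)
      = lin (\<lambda>x. lin (\<lambda>y. lin (\<lambda>z. of_frag (frag_extend (nf_bracket i z) (nf_bracket j x y))) r) q) p"
    unfolding comb_bracket_comb_bracket lin_swap[of _ p r] lin_swap[of _ q r] ..
  moreover have "comb_bracket i q (comb_bracket j r p)
      = lin (\<lambda>x. lin (\<lambda>y. lin (\<lambda>z. of_frag (frag_extend (nf_bracket i y) (nf_bracket j z x))) r) q) p"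
    unfolding comb_bracket_comb_bracket lin_swap[of _ p r] lin_swap[of _ p q] ..
  ultimately show ?thesis
    unfolding comb_bracket_comb_bracket jacobiator_def of_frag_add lin_add_fun by simp
qed

primrec comb_expansion :: "('c::linorder, 'a::linorder) bracketing \<Rightarrow> ('c, 'a) bracketing \<Rightarrow>\<^sub>0 'k::field" where
  "comb_expansion (Gen a) = Poly_Mapping.single (Gen a) 1"
| "comb_expansion (Br i s t) = comb_bracket i (comb_expansion s) (comb_expansion t)"

lemma comb_bracket_add_left: "comb_bracket i (p + p') q = comb_bracket i p q + comb_bracket i p' q"
  by (simp add: comb_bracket_def lin_add)

lemma comb_bracket_add_right: "comb_bracket i p (q + q') = comb_bracket i p q + comb_bracket i p q'"
  by (simp add: comb_bracket_def lin_add lin_add_fun)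

lemma comb_bracket_fscale_left: "comb_bracket i (fscale c p) q = fscale c (comb_bracket i p q)"
  by (simp add: comb_bracket_def lin_fscale)

lemma comb_bracket_fscale_right: "comb_bracket i p (fscale c q) = fscale c (comb_bracket i p q)"
  by (simp add: comb_bracket_def lin_fscale lin_fscale_fun)

lemma fscale_fscale: "fscale c (fscale d p) = fscale (c * d) p"
  by (rule poly_mapping_eqI) (simp add: lookup_fscale)

lemma fbracket_single:
  "fbracket i (Poly_Mapping.single s c) (Poly_Mapping.single t d) = Poly_Mapping.single (Br i s t) (c * d)"
  by (rule poly_mapping_eqI) (auto simp: lookup_fbracket lookup_single when_def split: bracketing.splits)

lemma lin_comb_expansion_fbracket:
  "lin comb_expansion (fbracket i p q) = comb_bracket i (lin comb_expansion p) (lin comb_expansion q)"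
proof (induction p rule: poly_mapping_add_induct)
  case (single s c)
  show ?case
  proof (induction q rule: poly_mapping_add_induct)
    case (single t d)
    show ?case
      by (simp add: fbracket_single lin_single comb_bracket_fscale_left comb_bracket_fscale_right fscale_fscale
          mult.commute)
  qed (simp add: fbracket_add_right lin_add comb_bracket_add_right)
qed (simp add: fbracket_add_left lin_add comb_bracket_add_left)

text \<open>\<open>comb_bracket\<close> satisfies all defining relations and the expansion turns
  \<open>fbracket\<close> into it. Hence the expansion descends to the quotient, as
  \<open>comb_coords\<close>.\<close>

lemma lin_comb_expansion_lie_ideal: "p \<in> lie_ideal X \<Longrightarrow> lin comb_expansion p = 0"
proof (induction rule: lie_ideal.induct)
  case (antisym x y i)
  show ?case by (simp add: lin_add lin_comb_expansion_fbracket comb_bracket_antisym)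
next
  case (jacobi x y z i)
  show ?case
    by (simp add: lin_add lin_comb_expansion_fbracket comb_bracket_jacobiator nf_bracket_jacobi lin_eq_0)
next
  case (compat x y z i j)
  let ?p = "lin comb_expansion x" and ?q = "lin comb_expansion y" and ?r = "lin comb_expansion z"
  have "comb_bracket i ?p (comb_bracket j ?q ?r) + comb_bracket i ?r (comb_bracket j ?p ?q)
     + comb_bracket i ?q (comb_bracket j ?r ?p) + (comb_bracket j ?p (comb_bracket i ?q ?r)
     + comb_bracket j ?r (comb_bracket i ?p ?q) + comb_bracket j ?q (comb_bracket i ?r ?p)) = 0"
    unfolding comb_bracket_jacobiator lin_add_fun[symmetric] of_frag_add[symmetric] nf_bracket_compat
    by (simp add: lin_eq_0)
  thus ?case by (simp add: lin_add lin_comb_expansion_fbracket add.assoc)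
next
  case (left p q i)
  thus ?case by (simp add: lin_comb_expansion_fbracket comb_bracket_def)
next
  case (right p q i)
  thus ?case by (simp add: lin_comb_expansion_fbracket comb_bracket_def lin_eq_0)
qed (simp_all add: lin_add lin_fscale)

lemma lin_diff: "lin f (p - q) = lin f p - lin f q"
  using lin_add[of f "p - q" q] by (simp add: algebra_simps)

lift_definition comb_coords :: "('c::linorder, 'a::linorder, 'k) free_lie \<Rightarrow> ('c, 'a) bracketing \<Rightarrow>\<^sub>0 'k::field"
  is "lin comb_expansion"
proof -
  fix p q :: "('c, 'a) bracketing \<Rightarrow>\<^sub>0 'k"
  assume "lie_rel p q"
  hence "lin comb_expansion (p - q) = (0 :: ('c, 'a) bracketing \<Rightarrow>\<^sub>0 'k)"
    unfolding lie_rel_def by (rule lin_comb_expansion_lie_ideal)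
  thus "lin comb_expansion p = (lin comb_expansion q :: ('c, 'a) bracketing \<Rightarrow>\<^sub>0 'k)"
    by (simp add: lin_diff)
qed

lemma comb_coords_add: "comb_coords (x + y) = comb_coords x + comb_coords y"
  by transfer (rule lin_add)

lemma comb_coords_0 [simp]: "comb_coords 0 = 0"
  by transfer simp

lemma comb_coords_scale: "comb_coords (lie_scale c x) = fscale c (comb_coords x)"
  by transfer (rule lin_fscale)

lemma comb_coords_bracket:
  "comb_coords (lie_bracket i x y) = comb_bracket i (comb_coords x) (comb_coords y)"
  by transfer (rule lin_comb_expansion_fbracket)

lemma comb_coords_gen: "comb_coords (lie_gen a) = Poly_Mapping.single (Gen a) 1"
  by transfer (simp add: lin_single)

text \<open>The counterpart of a normalized tree; for distinct labels the notions agree by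
  \<open>normalized_shape\<close>.\<close>

primrec increasing :: "('c, 'a::linorder) bracketing \<Rightarrow> bool" where
  "increasing (Gen a) \<longleftrightarrow> True"
| "increasing (Br i s t) \<longleftrightarrow> increasing s \<and> increasing t \<and> least_label s < least_label t"

text \<open>Increasing multilinear combs are already normal forms, so their coordinate vectors are
  unit vectors. Linear independence rests on this.\<close>

lemma comb_coords_lie_eval:
  assumes "comb t" "increasing t" "\<forall>a. count (labels t) a \<le> 1"
  shows "comb_coords (lie_eval t) = Poly_Mapping.single t 1"
  using assms
proof (induction t)
  case (Br i s t)
  have le: "count (labels s) a + count (labels t) a \<le> 1" for a
    using Br.prems(3) by simp
  hence "\<forall>a. count (labels s) a \<le> 1" "\<forall>a. count (labels t) a \<le> 1"
    using add_leD1 add_leD2 by blast+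
  moreover have "disjoint_labels s t"
  proof (rule ccontr)
    assume "\<not> ?thesis"
    then obtain a where "a \<in># labels s" "a \<in># labels t" by blast
    thus False using le[of a] by (simp flip: count_greater_zero_iff)
  qed
  ultimately show ?case
    using Br by (simp add: comb_coords_bracket comb_bracket_def lin_single nf_bracket_def
        nf_comb of_frag_frag_of)
qed (simp add: comb_coords_gen)

section \<open>Combs span\<close>

definition lie_comb :: "(('c, 'a) bracketing \<Rightarrow>\<^sub>0 int) \<Rightarrow> ('c, 'a, 'k::field) free_lie" where
  "lie_comb p = (\<Sum>t\<in>Poly_Mapping.keys p. lie_scale (of_int (Poly_Mapping.lookup p t)) (lie_eval t))"

lemma lie_comb_superset:
  assumes "finite S" "Poly_Mapping.keys p \<subseteq> S"
  shows "lie_comb p = (\<Sum>t\<in>S. lie_scale (of_int (Poly_Mapping.lookup p t)) (lie_eval t))"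
  unfolding lie_comb_def using assms by (intro sum.mono_neutral_left) (auto simp: in_keys_iff)

lemma lie_comb_frag_of [simp]: "lie_comb (frag_of t) = lie_eval t"
  by (simp add: lie_comb_def)

lemma lie_comb_0 [simp]: "lie_comb 0 = 0"
  by (simp add: lie_comb_def)

lemma lie_comb_add: "lie_comb (p + q) = lie_comb p + lie_comb q"
proof -
  let ?S = "Poly_Mapping.keys p \<union> Poly_Mapping.keys q"
  have "Poly_Mapping.keys (p + q) \<subseteq> ?S" by (rule Poly_Mapping.keys_add)
  thus ?thesis
    by (simp add: lie_comb_superset[of ?S] lookup_add free_lie.scale_left_distrib sum.distrib)
qed

lemma lie_comb_diff: "lie_comb (p - q) = lie_comb p - lie_comb q"
  by (metis add_diff_cancel_right' diff_add_cancel lie_comb_add)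

lemma lie_comb_frag_cmul: "lie_comb (frag_cmul c p) = lie_scale (of_int c) (lie_comb p)"
  by (simp add: lie_comb_superset[of "Poly_Mapping.keys p"] keys_cmul free_lie.scale_sum_right)

lemma lie_comb_sum: "lie_comb (sum h A) = (\<Sum>x\<in>A. lie_comb (h x))"
  by (induction A rule: infinite_finite_induct) (simp_all add: lie_comb_add)

lemma lie_comb_frag_extend:
  assumes "\<And>t. t \<in> Poly_Mapping.keys p \<Longrightarrow>
    (lie_comb (f t) :: ('c, 'a, 'k::field) free_lie) = lie_eval t"
  shows "(lie_comb (frag_extend f p) :: ('c, 'a, 'k) free_lie) = lie_comb p"
  using assms by (simp add: frag_extend_def lie_comb_sum lie_comb_frag_cmul lie_comb_def[of p])

lemma lie_bracket_diff_left: "lie_bracket i (x - y) z = lie_bracket i x z - lie_bracket i y z"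
  by transfer (simp add: fbracket_diff_left lie_rel_def lie_ideal.zero)

lemma lie_bracket_diff_right: "lie_bracket i z (x - y) = lie_bracket i z x - lie_bracket i z y"
  by transfer (simp add: fbracket_diff_right lie_rel_def lie_ideal.zero)

lemma lie_bracket_0_left [simp]: "lie_bracket i 0 z = 0"
  using lie_bracket_diff_left[of i 0 0 z] by simp

lemma lie_bracket_0_right [simp]: "lie_bracket i z 0 = 0"
  using lie_bracket_diff_right[of i z 0 0] by simp

lemma lie_bracket_swap: "lie_bracket i y x = - lie_bracket i x y"
  using lie_bracket_antisym[of i x y] by (simp add: eq_neg_iff_add_eq_0 add.commute)

lemma lie_bracket_uminus_left [simp]: "lie_bracket i (- x) y = - lie_bracket i x y"
  using lie_bracket_diff_left[of i 0 x y] by simp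

lemma lie_bracket_uminus_right [simp]: "lie_bracket i x (- y) = - lie_bracket i x y"
  using lie_bracket_diff_right[of i x 0 y] by simp

lemma lie_comb_Br_left:
  "lie_comb (frag_extend (\<lambda>x. frag_of (Br i x t)) p) = lie_bracket i (lie_comb p) (lie_eval t)"
  by (induction p rule: frag_induction[OF subset_UNIV])
    (simp_all add: frag_extend_diff lie_comb_diff lie_bracket_diff_left)

lemma lie_comb_Br_right:
  "lie_comb (frag_extend (\<lambda>x. frag_of (Br i s x)) p) = lie_bracket i (lie_eval s) (lie_comb p)"
  by (induction p rule: frag_induction[OF subset_UNIV])
    (simp_all add: frag_extend_diff lie_comb_diff lie_bracket_diff_right)

text \<open>\<open>root_red\<close> is the Jacobi or compatibility relation solved for
  \<open>[s, [u, v]]\<close>; \<open>flip\<close> brings the other cyclic terms into left-nested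
  form by antisymmetry.\<close>

lemma lie_comb_root_red:
  "lie_comb (root_red i s (Br j u v)) = lie_bracket i (lie_eval s) (lie_bracket j (lie_eval u) (lie_eval v))"
proof -
  let ?s = "lie_eval s" and ?u = "lie_eval u" and ?v = "lie_eval v"
  have flip: "lie_bracket i ?v (lie_bracket j ?s ?u) = - lie_bracket i (lie_bracket j ?s ?u) ?v"
    "lie_bracket i ?u (lie_bracket j ?v ?s) = lie_bracket i (lie_bracket j ?s ?v) ?u" for i j
    by (simp_all add: lie_bracket_swap[of i ?v] lie_bracket_swap[of i ?u] lie_bracket_swap[of j ?v])
  have "lie_bracket i ?s (lie_bracket j ?u ?v) = lie_comb (root_red i s (Br j u v))"
  proof (cases "i = j")
    case True
    thus ?thesis
      using lie_bracket_jacobi[of i ?s ?u ?v] unfolding flip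
      by (simp add: lie_comb_diff algebra_simps eq_neg_iff_add_eq_0)
  next
    case False
    thus ?thesis
      using lie_bracket_compat[OF False, of ?s ?u ?v] unfolding flip
      by (simp add: lie_comb_diff lie_comb_add algebra_simps eq_neg_iff_add_eq_0)
  qed
  thus ?thesis ..
qed

lemma lie_comb_red: "\<not> comb t \<Longrightarrow> lie_comb (red t) = lie_eval t"
proof (induction t)
  case (Br i s t)
  consider "\<not> comb s" | "comb s" "\<not> comb t" | "comb s" "comb t" by blast
  thus ?case
  proof cases
    case 3
    then obtain j u v where t: "t = Br j u v"
      using Br.prems by (cases t) auto
    show ?thesis using 3 lie_comb_root_red[of i s j u v] by (simp add: t)
  qed (use Br.IH in \<open>simp_all add: lie_comb_Br_left lie_comb_Br_right\<close>)
qed simp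

lemma lie_comb_nf: "lie_comb (nf t) = (lie_eval t :: ('c::linorder, 'a, 'k::field) free_lie)"
proof (induction t rule: tree_less_induct)
  case (less t)
  show ?case
  proof (cases "comb t")
    case False
    have "lie_comb (frag_extend nf (red t)) = (lie_comb (red t) :: ('c, 'a, 'k) free_lie)"
      by (intro lie_comb_frag_extend less red_less False)
    with False show ?thesis by (simp add: nf_red lie_comb_red)
  qed (simp add: nf_comb)
qed

text \<open>If the least labels of \<open>s\<close>, \<open>u\<close>, \<open>v\<close> increase,
  then each node of \<open>(su)v\<close>, \<open>(sv)u\<close> and \<open>s(uv)\<close> still has
  the smaller least label on its left.\<close>

lemma red_increasing: "w \<in> Poly_Mapping.keys (red t) \<Longrightarrow> increasing t \<Longrightarrow> increasing w"
proof (induction t arbitrary: w)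
  case (Br i s t)
  consider "\<not> comb s" | "comb s" "\<not> comb t" | "comb s" "comb t" by blast
  thus ?case
  proof cases
    case 1
    with Br.prems keys_frag_extend_frag_of[of "\<lambda>x. Br i x t" "red s"]
    obtain x where x: "x \<in> Poly_Mapping.keys (red s)" "w = Br i x t" by auto
    hence "labels x = labels s" using red_content by blast
    thus ?thesis using x Br by (simp add: least_label_def)
  next
    case 2
    with Br.prems keys_frag_extend_frag_of[of "\<lambda>x. Br i s x" "red t"]
    obtain x where x: "x \<in> Poly_Mapping.keys (red t)" "w = Br i s x" by auto
    hence "labels x = labels t" using red_content by blast
    thus ?thesis using x Br by (simp add: least_label_def)
  next
    case 3
    show ?thesis
    proof (cases t)
      case (Br j u v)
      thus ?thesis
        using 3 Br.prems keys_root_red[of w i s j u v] by (auto simp: min_def split: if_splits)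
    qed (use 3 Br.prems in auto)
  qed
qed simp

lemma nf_increasing: "w \<in> Poly_Mapping.keys (nf t) \<Longrightarrow> increasing t \<Longrightarrow> increasing w"
proof (induction t arbitrary: w rule: tree_less_induct)
  case (less t)
  show ?case
  proof (cases "comb t")
    case False
    with less.prems keys_frag_extend[of nf "red t"] obtain x
      where "x \<in> Poly_Mapping.keys (red t)" "w \<in> Poly_Mapping.keys (nf x)"
      by (auto simp: nf_red)
    with less.IH[OF red_less[OF False]] red_increasing less.prems show ?thesis by metis
  qed (use less.prems in \<open>auto simp: nf_comb\<close>)
qed

text \<open>Exchanging the two factors wherever their least labels are out of order costs only a
  sign.\<close>

lemma ex_increasing:
  assumes "\<forall>a. count (labels t) a \<le> 1"
  shows "\<exists>s. increasing s \<and> colours s = colours t \<and> labels s = labels t \<and>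
    (lie_eval s :: ('c, 'a::linorder, 'k::field) free_lie) \<in> {lie_eval t, - lie_eval t}"
  using assms
proof (induction t)
  case (Br i s t)
  have le: "count (labels s) a + count (labels t) a \<le> 1" for a
    using Br.prems by simp
  have dis: "disjoint_labels s t"
  proof (rule ccontr)
    assume "\<not> ?thesis"
    then obtain a where "a \<in># labels s" "a \<in># labels t" by blast
    thus False using le[of a] by (simp flip: count_greater_zero_iff)
  qed
  from le have "\<forall>a. count (labels s) a \<le> 1" "\<forall>a. count (labels t) a \<le> 1"
    using add_leD1 add_leD2 by blast+
  then obtain s' t' where s': "increasing s'" "colours s' = colours s" "labels s' = labels s"
      "(lie_eval s' :: ('c, 'a, 'k) free_lie) \<in> {lie_eval s, - lie_eval s}"
    and t': "increasing t'" "colours t' = colours t" "labels t' = labels t"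
      "(lie_eval t' :: ('c, 'a, 'k) free_lie) \<in> {lie_eval t, - lie_eval t}"
    using Br.IH by blast
  have "least_label s' \<noteq> least_label t'"
    using least_label_neq[OF dis] s' t' by (simp add: least_label_def)
  then consider "least_label s' < least_label t'" | "least_label t' < least_label s'" by fastforce
  thus ?case
  proof cases
    case 1
    with s' t' show ?thesis by (intro exI[of _ "Br i s' t'"]) auto
  next
    case 2
    with s' t' show ?thesis
      by (intro exI[of _ "Br i t' s'"])
        (auto simp: add_ac lie_bracket_swap[of i "lie_eval t"])
  qed
qed (auto intro!: exI[of _ "Gen _"])

section \<open>The comb basis of a multidegree component\<close>

definition colour_content :: "('c, 'a) bracketing \<Rightarrow> 'c \<Rightarrow>\<^sub>0 nat" where
  "colour_content t = (\<Sum>i\<in>#colours t. Poly_Mapping.single i 1)"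

definition normal_combs :: "nat \<Rightarrow> ('c::linorder, nat) bracketing set" where
  "normal_combs n = {t. comb t \<and> increasing t \<and> labels t = mset_set {1..n}}"

lemma lookup_colour_content: "Poly_Mapping.lookup (colour_content t) i = count (colours t) i"
proof -
  have "Poly_Mapping.lookup (\<Sum>i\<in>#M. Poly_Mapping.single i (1::nat)) i = count M i" for M :: "'a multiset"
    by (induction M) (auto simp: lookup_add lookup_single)
  thus ?thesis by (simp add: colour_content_def)
qed

lemma count_br_eq_count_colours: "count_br t i = count (colours t) i"
  by (induction t) auto

lemma mset_gens_list: "mset (gens_list t) = labels t"
  by (induction t) auto

lemma distinct_set_iff_mset: "distinct xs \<and> set xs = {1..n} \<longleftrightarrow> mset xs = mset_set {1..n::nat}"
proof
  assume mset: "mset xs = mset_set {1..n}"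
  hence "set xs = {1..n}" by (metis finite_atLeastAtMost finite_set_mset_mset_set set_mset_mset)
  moreover have "distinct xs"
    unfolding distinct_count_atmost_1 mset using \<open>set xs = {1..n}\<close> by (simp add: count_mset_set')
  ultimately show "distinct xs \<and> set xs = {1..n}" by blast
qed (metis mset_set_set)

lemma bracketed_perms_eq:
  "bracketed_perms n \<mu> = {t. labels t = mset_set {1..n} \<and> colour_content t = \<mu>}"
  unfolding bracketed_perms_def conj_assoc[symmetric] distinct_set_iff_mset
  by (simp add: count_br_eq_count_colours poly_mapping_eq_iff lookup_colour_content fun_eq_iff mset_gens_list)

text \<open>Each bracketed permutation is, up to sign, increasing, and its normal form is an integer
  combination of increasing combs of the same content.\<close>

lemma Lie_eq_span_combs:
  "(Lie n \<mu> :: ('c::linorder, nat, 'k::field) free_lie set)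
    = lie_span (lie_eval ` {t \<in> normal_combs n. colour_content t = \<mu>})" (is "_ = lie_span (lie_eval ` ?C)")
proof (rule equalityI)
  show "(Lie n \<mu> :: ('c, nat, 'k) free_lie set) \<subseteq> lie_span (lie_eval ` ?C)"
    unfolding Lie_def
  proof (rule free_lie.span_minimal)
    show "(lie_eval ` bracketed_perms n \<mu> :: ('c, nat, 'k) free_lie set) \<subseteq> lie_span (lie_eval ` ?C)"
    proof (intro image_subsetI)
      fix t :: "('c, nat) bracketing"
      assume "t \<in> bracketed_perms n \<mu>"
      hence t: "labels t = mset_set {1..n}" "colour_content t = \<mu>"
        by (simp_all add: bracketed_perms_eq)
      moreover from this have "\<forall>a. count (labels t) a \<le> 1"
        by (simp add: count_mset_set')
      ultimately obtain s where s: "increasing s" "colours s = colours t" "labels s = labels t"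
          "(lie_eval s :: ('c, nat, 'k) free_lie) \<in> {lie_eval t, - lie_eval t}"
        using ex_increasing[of t, where ?'k = 'k] by blast
      have "Poly_Mapping.keys (nf s) \<subseteq> ?C"
        using keys_nf nf_increasing s t by (auto simp: normal_combs_def colour_content_def)
      hence "lie_comb (nf s) \<in> (lie_span (lie_eval ` ?C) :: ('c, nat, 'k) free_lie set)"
        unfolding lie_comb_def
        by (intro free_lie.span_sum free_lie.span_scale free_lie.span_base) auto
      hence "lie_eval s \<in> (lie_span (lie_eval ` ?C) :: ('c, nat, 'k) free_lie set)"
        by (simp add: lie_comb_nf)
      thus "lie_eval t \<in> (lie_span (lie_eval ` ?C) :: ('c, nat, 'k) free_lie set)"
        using s(4) free_lie.span_neg by fastforce
    qed
  qed (rule free_lie.subspace_span)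
  show "lie_span (lie_eval ` ?C) \<subseteq> (Lie n \<mu> :: ('c, nat, 'k) free_lie set)"
    unfolding Lie_def
    by (intro free_lie.span_mono image_mono) (auto simp: bracketed_perms_eq normal_combs_def)
qed

lemma lie_dim_Lie:
  "lie_dim (Lie n \<mu> :: ('c::linorder, nat, 'k::field) free_lie set)
    = card {t \<in> normal_combs n. colour_content t = \<mu>}" (is "_ = card ?C")
proof -
  have coords: "comb_coords (lie_eval t :: ('c, nat, 'k) free_lie) = Poly_Mapping.single t 1"
    if "t \<in> ?C" for t
    using that by (intro comb_coords_lie_eval) (auto simp: normal_combs_def count_mset_set')
  have inj: "inj_on (lie_eval :: _ \<Rightarrow> ('c, nat, 'k) free_lie) ?C"
  proof (rule inj_onI)
    fix s t assume "s \<in> ?C" "t \<in> ?C" "(lie_eval s :: ('c, nat, 'k) free_lie) = lie_eval t"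
    hence "Poly_Mapping.single s (1::'k) = Poly_Mapping.single t 1"
      using coords by metis
    thus "s = t"
      by (metis lookup_single_eq lookup_single_not_eq zero_neq_one)
  qed
  have "\<not> free_lie.dependent (lie_eval ` ?C :: ('c, nat, 'k) free_lie set)"
  proof
    assume "free_lie.dependent (lie_eval ` ?C :: ('c, nat, 'k) free_lie set)"
    then obtain T u w where T: "finite T" "T \<subseteq> lie_eval ` ?C"
      and zero: "(\<Sum>v\<in>T. lie_scale (u v) v) = (0 :: ('c, nat, 'k) free_lie)"
      and w: "w \<in> T" "u w \<noteq> 0"
      unfolding free_lie.dependent_explicit by blast
    obtain t where t: "t \<in> ?C" "w = lie_eval t" using w T by blast
    have sum: "comb_coords (\<Sum>v\<in>A. lie_scale (u v) v) = (\<Sum>v\<in>A. fscale (u v) (comb_coords v))" for A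
      by (induction A rule: infinite_finite_induct) (simp_all add: comb_coords_add comb_coords_scale)
    \<comment> \<open>The coordinate at \<open>t\<close> of the vanishing combination isolates the
      coefficient of \<open>w\<close>.\<close>
    have "0 = Poly_Mapping.lookup (comb_coords (\<Sum>v\<in>T. lie_scale (u v) v)) t"
      by (simp add: zero)
    also have "\<dots> = (\<Sum>v\<in>T. u v * Poly_Mapping.lookup (comb_coords v) t)"
      by (simp add: sum lookup_sum lookup_fscale)
    also have "\<dots> = (\<Sum>v\<in>T. if v = w then u v else 0)"
    proof (intro sum.cong refl)
      fix v assume "v \<in> T"
      then obtain s where "s \<in> ?C" "v = lie_eval s" using T by blast
      thus "u v * Poly_Mapping.lookup (comb_coords v) t = (if v = w then u v else 0)"
        using t coords inj_onD[OF inj, of s t] by (auto simp: lookup_single when_def)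
    qed
    also have "\<dots> = u w" using w T by simp
    finally show False using w by simp
  qed
  hence "lie_dim (Lie n \<mu> :: ('c, nat, 'k) free_lie set) = card (lie_eval ` ?C :: ('c, nat, 'k) free_lie set)"
    unfolding Lie_eq_span_combs by (rule free_lie.dim_span_eq_card_independent)
  also have "\<dots> = card ?C" using inj by (rule card_image)
  finally show ?thesis .
qed

section \<open>Counting colourings\<close>

text \<open>With infinitely many colours a tree may have infinitely many colourings; the condition
  makes \<open>card\<close> meaningful on each weight class.\<close>

definition graded :: "('b \<Rightarrow> 'v \<Rightarrow>\<^sub>0 nat) \<Rightarrow> 'b set \<Rightarrow> bool" where
  "graded w X \<longleftrightarrow> (\<forall>\<mu>. finite {x \<in> X. w x = \<mu>})"

definition count_series :: "('b \<Rightarrow> 'v \<Rightarrow>\<^sub>0 nat) \<Rightarrow> 'b set \<Rightarrow> ('v, int) mps" where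
  "count_series w X = mps_of (\<lambda>\<mu>. int (card {x \<in> X. w x = \<mu>}))"

lemma bij_betw_weight:
  assumes "bij_betw h X Y" "\<And>x. x \<in> X \<Longrightarrow> v (h x) = w x"
  shows "bij_betw h {x \<in> X. w x = \<mu>} {y \<in> Y. v y = \<mu>}"
  using assms unfolding bij_betw_def by (auto intro: inj_on_subset)

lemma count_series_cong_bij:
  assumes "bij_betw h X Y" "\<And>x. x \<in> X \<Longrightarrow> v (h x) = w x"
  shows "count_series w X = count_series v Y"
proof -
  have *: "bij_betw h {x \<in> X. w x = \<mu>} {y \<in> Y. v y = \<mu>}" for \<mu>
    using assms by (rule bij_betw_weight)
  show ?thesis by (simp add: count_series_def bij_betw_same_card[OF *])
qed

lemma graded_cong_bij:
  assumes "bij_betw h X Y" "\<And>x. x \<in> X \<Longrightarrow> v (h x) = w x"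
  shows "graded w X \<longleftrightarrow> graded v Y"
proof -
  have *: "bij_betw h {x \<in> X. w x = \<mu>} {y \<in> Y. v y = \<mu>}" for \<mu>
    using assms by (rule bij_betw_weight)
  show ?thesis by (simp add: graded_def bij_betw_finite[OF *])
qed

lemma weight_Times_eq:
  "{p \<in> X \<times> Y. v (fst p) + w (snd p) = \<mu>}
    = (\<Union>q\<in>{(a, b). a + b = \<mu>}. {x \<in> X. v x = fst q} \<times> {y \<in> Y. w y = snd q})"
  by auto

lemma graded_Times:
  assumes "graded v X" "graded w Y"
  shows "graded (\<lambda>p. v (fst p) + w (snd p)) (X \<times> Y)"
  unfolding graded_def weight_Times_eq
proof
  fix \<mu>
  show "finite (\<Union>q\<in>{(a, b). a + b = \<mu>}. {x \<in> X. v x = fst q} \<times> {y \<in> Y. w y = snd q})"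
    using assms by (intro finite_UN_I finite_monomial_splits finite_cartesian_product) (simp_all add: graded_def)
qed

text \<open>A pair of weight \<mu> is a splitting of \<mu> with one element from each of the two
  weight classes, as in the Cauchy product.\<close>

lemma count_series_Times:
  assumes "graded v X" "graded w Y"
  shows "count_series (\<lambda>p. v (fst p) + w (snd p)) (X \<times> Y) = count_series v X * count_series w Y"
proof (rule mps_eqI)
  fix \<mu>
  have "card {p \<in> X \<times> Y. v (fst p) + w (snd p) = \<mu>}
      = (\<Sum>q\<in>{(a, b). a + b = \<mu>}. card ({x \<in> X. v x = fst q} \<times> {y \<in> Y. w y = snd q}))"
    unfolding weight_Times_eq
  proof (rule card_UN_disjoint)
    show "\<forall>q\<in>{(a, b). a + b = \<mu>}. finite ({x \<in> X. v x = fst q} \<times> {y \<in> Y. w y = snd q})"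
      using assms by (simp add: graded_def)
  qed (rule finite_monomial_splits, force)
  thus "mps_nth (count_series (\<lambda>p. v (fst p) + w (snd p)) (X \<times> Y)) \<mu>
      = mps_nth (count_series v X * count_series w Y) \<mu>"
    by (simp add: count_series_def times_mps.rep_eq card_cartesian_product split_def)
qed

section \<open>Elementary symmetric functions as enumerators of subsets\<close>

lemma inj_on_weight_class:
  assumes "inj_on w X"
  shows "{x \<in> X. w x = \<mu>} = (if \<mu> \<in> w ` X then {the_inv_into X w \<mu>} else {})"
proof (cases "\<mu> \<in> w ` X")
  case True
  then obtain x where x: "x \<in> X" "\<mu> = w x" by blast
  have "{y \<in> X. w y = w x} = {x}"
    using x(1) inj_onD[OF assms] by blast
  thus ?thesis using x by (simp add: the_inv_into_f_f[OF assms])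
qed auto

text \<open>A squarefree monomial determines its set of variables, so the coefficients of
  \<open>elem_sym\<close> count subsets.\<close>

lemma inj_on_sum_single: "inj_on (\<lambda>S. \<Sum>i\<in>S. Poly_Mapping.single i (1::nat)) {S. finite S \<and> card S = k}"
proof (rule inj_onI, rule set_eqI)
  fix S T :: "'a set" and x
  have lk: "Poly_Mapping.lookup (\<Sum>i\<in>S. Poly_Mapping.single i (1::nat)) x = (if x \<in> S then 1 else 0)"
    if "finite S" for S :: "'a set"
    using that by (simp add: lookup_sum lookup_single when_def)
  assume S: "S \<in> {S. finite S \<and> card S = k}" and T: "T \<in> {S. finite S \<and> card S = k}"
    and eq: "(\<Sum>i\<in>S. Poly_Mapping.single i (1::nat)) = (\<Sum>i\<in>T. Poly_Mapping.single i 1)"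
  have "(if x \<in> S then 1 else 0 :: nat) = (if x \<in> T then 1 else 0)"
    using arg_cong[OF eq, of "\<lambda>p. Poly_Mapping.lookup p x"] S T unfolding mem_Collect_eq by (simp only: lk)
  thus "x \<in> S \<longleftrightarrow> x \<in> T"
    by (cases "x \<in> S"; cases "x \<in> T") simp_all
qed

lemma graded_subsets: "graded (\<lambda>S. \<Sum>i\<in>S. Poly_Mapping.single i 1) {S. finite S \<and> card S = k}"
  unfolding graded_def inj_on_weight_class[OF inj_on_sum_single] by simp

lemma elem_sym_eq_count_series:
  "elem_sym k = count_series (\<lambda>S. \<Sum>i\<in>S. Poly_Mapping.single i 1) {S. finite S \<and> card S = k}"
proof -
  have "{\<Sum>i\<in>S. Poly_Mapping.single i 1 | S. finite S \<and> card S = k}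
      = (\<lambda>S. \<Sum>i\<in>S. Poly_Mapping.single i 1) ` {S :: 'a set. finite S \<and> card S = k}"
    by (rule setcompr_eq_image)
  note eq = this
  show ?thesis
    unfolding elem_sym_def gen_series_def count_series_def eq inj_on_weight_class[OF inj_on_sum_single]
    by (intro arg_cong[of _ _ mps_of] ext) simp
qed

lemma elem_sym_0: "elem_sym 0 = 1"
proof (rule mps_eqI)
  fix \<mu> :: "'a \<Rightarrow>\<^sub>0 nat"
  have "finite S \<and> card S = 0 \<longleftrightarrow> S = {}" for S :: "'a set"
    by (metis card_0_eq card.empty finite.emptyI)
  thus "mps_nth (elem_sym 0 :: ('a, 'b::comm_ring_1) mps) \<mu> = mps_nth 1 \<mu>"
    unfolding elem_sym_def gen_series_def mps_nth_mps_of one_mps.rep_eq by simp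
qed

section \<open>Right spines and their colourings\<close>

primrec shape :: "('c, 'a) bracketing \<Rightarrow> 'a lbtree" where
  "shape (Gen a) = Leaf a"
| "shape (Br i s t) = Node (shape s) (shape t)"

primrec spine_colours :: "('c, 'a) bracketing \<Rightarrow> 'c set" where
  "spine_colours (Gen a) = {}"
| "spine_colours (Br i s t) = insert i (spine_colours t)"

primrec spine_parts :: "('c, 'a) bracketing \<Rightarrow> ('c, 'a) bracketing list" where
  "spine_parts (Gen a) = []"
| "spine_parts (Br i s t) = s # spine_parts t"

primrec spine_length :: "'a lbtree \<Rightarrow> nat" where
  "spine_length (Leaf a) = 0"
| "spine_length (Node l r) = Suc (spine_length r)"

definition colourings :: "'a lbtree \<Rightarrow> ('c::linorder, 'a) bracketing set" where
  "colourings t = {T. comb T \<and> shape T = t}"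

text \<open>The possible values of \<open>spine_parts\<close>: the left subtrees hanging off the
  right spine are coloured independently, as \<open>comb\<close> does not compare them with the
  spine.\<close>

primrec part_colourings :: "'a lbtree \<Rightarrow> ('c::linorder, 'a) bracketing list set" where
  "part_colourings (Leaf a) = {[]}"
| "part_colourings (Node l r) = (\<lambda>(s, L). s # L) ` (colourings l \<times> part_colourings r)"

lemma finite_spine_colours [simp]: "finite (spine_colours T)"
  by (induction T) auto

text \<open>\<open>comb\<close> compares adjacent spine nodes only; by transitivity the root colour
  exceeds all colours further down the spine.\<close>

lemma comb_Br_iff: "comb (Br i s t) \<longleftrightarrow> comb s \<and> comb t \<and> (\<forall>j\<in>spine_colours t. j < i)"
proof -
  have "\<forall>k\<in>spine_colours t. k < i" if "comb t" "t = Br j u v" "j < i" for i j u v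
    using that
  proof (induction t arbitrary: i j u v)
    case (Br j' s t)
    show ?case
    proof (cases t)
      case (Br k u' v')
      with Br.prems Br.IH(2)[of k u' v' i] show ?thesis by auto
    qed (use Br.prems in auto)
  qed simp
  thus ?thesis by (cases t) auto
qed

lemma colourings_Node:
  "T \<in> colourings (Node l r) \<longleftrightarrow>
    (\<exists>i s t. T = Br i s t \<and> s \<in> colourings l \<and> t \<in> colourings r \<and> (\<forall>j\<in>spine_colours t. j < i))"
  by (cases T) (auto simp: colourings_def comb_Br_iff simp del: comb.simps(2))

lemma shape_eq_Leaf_iff: "shape T = Leaf a \<longleftrightarrow> T = Gen a"
  by (cases T) auto

lemma colourings_Leaf: "colourings (Leaf a) = {Gen a}"
  by (auto simp: colourings_def shape_eq_Leaf_iff)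

text \<open>
  A comb is recovered from the set of colours of its right spine, because they decrease along it.
\<close>

lemma bij_betw_colourings:
  "bij_betw (\<lambda>T :: ('c::linorder, 'a) bracketing. (spine_colours T, spine_parts T)) (colourings t)
    ({S. finite S \<and> card S = spine_length t} \<times> part_colourings t)"
proof (induction t)
  case (Leaf a)
  show ?case by (auto simp: bij_betw_def colourings_Leaf)
next
  case (Node l r)
  note inj = bij_betw_imp_inj_on[OF Node.IH(2)] and surj = bij_betw_imp_surj_on[OF Node.IH(2)]
  \<comment> \<open>The root colour is the largest of the spine, so both it and the remaining set
    are determined by the whole set.\<close>
  have Max: "i = Max (insert i (spine_colours t))" "spine_colours t = insert i (spine_colours t) - {i}"
    if "\<forall>j\<in>spine_colours t. j < i" for i and t :: "('c, 'a) bracketing"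
    using that by (auto intro!: Max_eqI[symmetric])
  show ?case
    unfolding bij_betw_def
  proof (intro conjI inj_onI equalityI subsetI)
    fix T T' :: "('c, 'a) bracketing"
    assume T: "T \<in> colourings (Node l r)" and T': "T' \<in> colourings (Node l r)"
      and eq: "(spine_colours T, spine_parts T) = (spine_colours T', spine_parts T')"
    from T obtain i s t where t: "T = Br i s t" "t \<in> colourings r" "\<forall>j\<in>spine_colours t. j < i"
      unfolding colourings_Node by blast
    from T' obtain i' s' t' where t': "T' = Br i' s' t'" "t' \<in> colourings r" "\<forall>j\<in>spine_colours t'. j < i'"
      unfolding colourings_Node by blast
    have ins: "insert i (spine_colours t) = insert i' (spine_colours t')"
      using eq t(1) t'(1) by simp
    have "i = i'"
      by (rule trans[OF Max(1)[OF t(3)] trans[OF _ Max(1)[OF t'(3), symmetric]]]) (simp only: ins)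
    moreover have "spine_colours t = spine_colours t'"
      by (rule trans[OF Max(2)[OF t(3)] trans[OF _ Max(2)[OF t'(3), symmetric]]])
        (subst ins, simp only: \<open>i = i'\<close>)
    ultimately show "T = T'"
      using eq inj_onD[OF inj, of t t'] t t' by simp
  next
    fix p :: "'c set \<times> ('c, 'a) bracketing list"
    assume "p \<in> (\<lambda>T. (spine_colours T, spine_parts T)) ` colourings (Node l r)"
    then obtain T where T: "T \<in> colourings (Node l r)" "p = (spine_colours T, spine_parts T)"
      by blast
    then obtain i s t where T': "T = Br i s t" and t: "s \<in> colourings l"
        "t \<in> colourings r" "\<forall>j\<in>spine_colours t. j < i"
      unfolding colourings_Node by blast
    have p: "p = (insert i (spine_colours t), s # spine_parts t)"
      by (simp add: T(2) T')
    have "(spine_colours t, spine_parts t) \<in> {S. finite S \<and> card S = spine_length r} \<times> part_colourings r"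
      unfolding surj[symmetric] using t(2) by (rule imageI)
    moreover have "i \<notin> spine_colours t"
      using t(3) by blast
    ultimately show "p \<in> {S. finite S \<and> card S = spine_length (Node l r)} \<times> part_colourings (Node l r)"
      using t(1) by (auto simp: p)
  next
    fix p :: "'c set \<times> ('c, 'a) bracketing list"
    assume "p \<in> {S. finite S \<and> card S = spine_length (Node l r)} \<times> part_colourings (Node l r)"
    then obtain S s L where p: "p = (S, s # L)" "finite S" "card S = Suc (spine_length r)"
        "s \<in> colourings l" "L \<in> part_colourings r"
      by auto
    define i where "i = Max S"
    have i: "i \<in> S" unfolding i_def using p by (intro Max_in) auto
    have "(S - {i}, L) \<in> {S. finite S \<and> card S = spine_length r} \<times> part_colourings r"
      using p i by simp
    then obtain t where t: "t \<in> colourings r" "spine_colours t = S - {i}" "spine_parts t = L"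
      unfolding surj[symmetric] by auto
    have "\<forall>j\<in>spine_colours t. j < i"
      using p(2) Max_ge[of S] unfolding t(2) i_def by (simp add: order_less_le)
    hence "Br i s t \<in> colourings (Node l r)"
      using t p by (auto simp: colourings_Node)
    moreover have "p = (spine_colours (Br i s t), spine_parts (Br i s t))"
      using p t i by auto
    ultimately show "p \<in> (\<lambda>T. (spine_colours T, spine_parts T)) ` colourings (Node l r)"
      by blast
  qed
qed

lemma colour_content_simps [simp]:
  "colour_content (Gen a) = 0"
  "colour_content (Br i s t) = Poly_Mapping.single i 1 + colour_content s + colour_content t"
  by (simp_all add: colour_content_def add.assoc)

abbreviation parts_content :: "('c, 'a) bracketing list \<Rightarrow> 'c \<Rightarrow>\<^sub>0 nat" where
  "parts_content L \<equiv> sum_list (map colour_content L)"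

lemma colour_content_spine:
  assumes "comb T"
  shows "colour_content T = (\<Sum>i\<in>spine_colours T. Poly_Mapping.single i 1) + parts_content (spine_parts T)"
  using assms
proof (induction T)
  case (Br i s t)
  hence "i \<notin> spine_colours t" "comb t" unfolding comb_Br_iff by auto
  thus ?case using Br.IH(2) by (simp add: ac_simps)
qed simp

text \<open>Under \<open>bij_betw_colourings\<close> the content splits into the squarefree monomial
  of the spine and the contents of the parts, so the series factors.\<close>

lemma count_series_colourings:
  assumes "graded parts_content (part_colourings t :: ('c::linorder, 'a) bracketing list set)"
  shows "graded colour_content (colourings t :: ('c, 'a) bracketing set)"
    and "count_series colour_content (colourings t :: ('c, 'a) bracketing set)
      = elem_sym (spine_length t) * count_series parts_content (part_colourings t)"
proof -
  define v where "v p = (\<Sum>i\<in>fst p. Poly_Mapping.single i 1) + parts_content (snd p)"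
    for p :: "'c set \<times> ('c, 'a) bracketing list"
  have v: "v (spine_colours T, spine_parts T) = colour_content T"
    if "T \<in> colourings t" for T :: "('c, 'a) bracketing"
    using that colour_content_spine[of T] by (simp add: colourings_def v_def)
  let ?Y = "{S :: 'c set. finite S \<and> card S = spine_length t} \<times> part_colourings t"
  have "graded v ?Y"
    unfolding v_def by (rule graded_Times[OF graded_subsets assms])
  thus "graded colour_content (colourings t :: ('c, 'a) bracketing set)"
    using graded_cong_bij[OF bij_betw_colourings, of t v colour_content] v by blast
  have "count_series colour_content (colourings t :: ('c, 'a) bracketing set) = count_series v ?Y"
    using count_series_cong_bij[OF bij_betw_colourings, of t v colour_content] v by blast
  also have "\<dots> = elem_sym (spine_length t) * count_series parts_content (part_colourings t)"
    unfolding v_def elem_sym_eq_count_series by (rule count_series_Times[OF graded_subsets assms])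
  finally show "count_series colour_content (colourings t :: ('c, 'a) bracketing set)
      = elem_sym (spine_length t) * count_series parts_content (part_colourings t)" .
qed

lemma bij_betw_part_colourings:
  "bij_betw (\<lambda>(s, L). s # L) (colourings l \<times> part_colourings r) (part_colourings (Node l r))"
  by (auto simp: bij_betw_def inj_on_def)

lemma graded_part_colourings:
  "graded parts_content (part_colourings t :: ('c::linorder, 'a) bracketing list set)"
proof (induction t)
  case (Leaf a)
  show ?case by (simp add: graded_def)
next
  case (Node l r)
  have "graded (\<lambda>p. colour_content (fst p) + parts_content (snd p))
      (colourings l \<times> part_colourings r :: (('c, 'a) bracketing \<times> _) set)"
    by (intro graded_Times count_series_colourings(1) Node.IH)
  moreover have "graded (\<lambda>p. colour_content (fst p) + parts_content (snd p))
      (colourings l \<times> part_colourings r :: (('c, 'a) bracketing \<times> _) set)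
    \<longleftrightarrow> graded parts_content (part_colourings (Node l r) :: ('c, 'a) bracketing list set)"
    by (rule graded_cong_bij[OF bij_betw_part_colourings]) (simp add: split_def)
  ultimately show ?case by blast
qed

lemma count_series_part_colourings:
  "count_series parts_content (part_colourings (Leaf a) :: ('c::linorder, 'a) bracketing list set) = 1"
  "count_series parts_content (part_colourings (Node l r) :: ('c, 'a) bracketing list set)
    = count_series colour_content (colourings l) * count_series parts_content (part_colourings r)"
proof -
  have "{L \<in> {[]}. parts_content L = \<mu>} = (if \<mu> = 0 then {[] :: ('c, 'a) bracketing list} else {})" for \<mu>
    by auto
  thus "count_series parts_content (part_colourings (Leaf a) :: ('c, 'a) bracketing list set) = 1"
    by (intro mps_eqI) (simp add: count_series_def one_mps.rep_eq)
  have "count_series (\<lambda>p. colour_content (fst p) + parts_content (snd p))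
      (colourings l \<times> part_colourings r :: (('c, 'a) bracketing \<times> _) set)
    = count_series parts_content (part_colourings (Node l r))"
    by (rule count_series_cong_bij[OF bij_betw_part_colourings]) (simp add: split_def)
  moreover have "count_series (\<lambda>p. colour_content (fst p) + parts_content (snd p))
      (colourings l \<times> part_colourings r :: (('c, 'a) bracketing \<times> _) set)
    = count_series colour_content (colourings l) * count_series parts_content (part_colourings r)"
    by (intro count_series_Times count_series_colourings(1) graded_part_colourings)
  ultimately show "count_series parts_content (part_colourings (Node l r) :: ('c, 'a) bracketing list set)
    = count_series colour_content (colourings l) * count_series parts_content (part_colourings r)"
    by (rule trans[OF sym])
qed

section \<open>The comb type\<close>

text \<open>The topmost node of the maximal chain of right edges through a node.\<close>

primrec chain_top :: "bool list \<Rightarrow> bool list" where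
  "chain_top [] = []"
| "chain_top (b # x) = (if b \<and> chain_top x = [] then [] else b # chain_top x)"

lemma chain_top_snoc_True [simp]: "chain_top (x @ [True]) = chain_top x"
  by (induction x) auto

lemma chain_top_decomp: "\<exists>k. x = chain_top x @ replicate k True"
proof (induction x)
  case (Cons b x)
  then obtain k where k: "x = chain_top x @ replicate k True" by blast
  show ?case
  proof (cases "b \<and> chain_top x = []")
    case True
    with k have "b # x = chain_top (b # x) @ replicate (Suc k) True" by simp
    thus ?thesis by blast
  next
    case False
    hence "chain_top (b # x) = b # chain_top x" by auto
    with k have "b # x = chain_top (b # x) @ replicate k True" by (metis append_Cons)
    thus ?thesis by blast
  qed
qed simp

lemma chain_top_idem [simp]: "chain_top (chain_top x) = chain_top x"
  by (induction x) auto

lemma inodes_prefix: "x @ y \<in> inodes t \<Longrightarrow> x \<in> inodes t"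
proof (induction t arbitrary: x)
  case (Node l r)
  thus ?case by (cases x) auto
qed simp

lemma finite_inodes [simp]: "finite (inodes t)"
  by (induction t) auto

lemma chain_top_in_inodes: "x \<in> inodes t \<Longrightarrow> chain_top x \<in> inodes t"
  using chain_top_decomp[of x] inodes_prefix by metis

section \<open>The blocks of the comb partition\<close>

definition chain_block :: "'a lbtree \<Rightarrow> bool list \<Rightarrow> bool list set" where
  "chain_block t y = {x \<in> inodes t. chain_top x = y}"

definition chain_tops :: "'a lbtree \<Rightarrow> bool list set" where
  "chain_tops t = {x \<in> inodes t. chain_top x = x}"

lemma finite_chain_tops [simp]: "finite (chain_tops t)"
  by (simp add: chain_tops_def)

text \<open>Grouping nodes by chain top gives a closed partition. It is the finest one because any
  closed partition, followed along right edges one at a time, keeps each chain in a single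
  block.\<close>

lemma comb_partition_eq: "comb_partition t = chain_block t ` chain_tops t"
proof -
  let ?P = "chain_block t ` chain_tops t"
  have "partition_on (inodes t) ?P"
  proof (rule partition_onI)
    show "\<Union> ?P = inodes t"
      using chain_top_in_inodes by (fastforce simp: chain_block_def chain_tops_def)
    show "{} \<notin> ?P"
      by (auto simp: chain_block_def chain_tops_def)
    show "disjnt p q" if "p \<in> ?P" "q \<in> ?P" "p \<noteq> q" for p q
      using that by (auto simp: chain_block_def disjnt_def)
  qed
  moreover have "\<exists>B\<in>?P. x \<in> B \<and> x @ [True] \<in> B" if "x \<in> inodes t" "x @ [True] \<in> inodes t" for x
    using that chain_top_in_inodes[of x t]
    by (intro bexI[of _ "chain_block t (chain_top x)"]) (auto simp: chain_block_def chain_tops_def)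
  ultimately have closed: "comb_closed t ?P"
    by (simp add: comb_closed_def)
  moreover have "refines (inodes t) ?P Q" if Q: "comb_closed t Q" for Q
    unfolding refines_def
  proof (intro conjI ballI)
    show "partition_on (inodes t) ?P" "partition_on (inodes t) Q"
      using closed Q by (simp_all add: comb_closed_def)
    fix X assume "X \<in> ?P"
    then obtain y where y: "y \<in> inodes t" "chain_top y = y" "X = chain_block t y"
      by (auto simp: chain_tops_def)
    obtain B where B: "B \<in> Q" "y \<in> B"
      using Q y(1) by (auto simp: comb_closed_def partition_on_def)
    have "y @ replicate k True \<in> B" if "y @ replicate k True \<in> inodes t" for k
      using that
    proof (induction k)
      case 0
      show ?case using B by simp
    next
      case (Suc k)
      let ?z = "y @ replicate k True"
      have step: "y @ replicate (Suc k) True = ?z @ [True]"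
        by (simp add: replicate_append_same)
      hence z: "?z \<in> inodes t" "?z @ [True] \<in> inodes t"
        using Suc.prems inodes_prefix by metis+
      then obtain C where C: "C \<in> Q" "?z \<in> C" "?z @ [True] \<in> C"
        using Q by (auto simp: comb_closed_def)
      have "C = B"
        using C B Suc.IH[OF z(1)] Q unfolding comb_closed_def partition_on_def disjoint_def by blast
      thus ?case using C step by simp
    qed
    note in_B = this
    have "X \<subseteq> B"
    proof
      fix x assume "x \<in> X"
      hence x: "x \<in> inodes t" "chain_top x = y" by (simp_all add: y(3) chain_block_def)
      with chain_top_decomp[of x] in_B show "x \<in> B" by metis
    qed
    thus "\<exists>Y\<in>Q. X \<subseteq> Y" using B by blast
  qed
  ultimately show ?thesis
    unfolding comb_partition_def by (intro the1_equality[OF ex1_comb_partition]) blast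
qed

section \<open>Recursion for the comb type\<close>

lemma chain_tops_Leaf [simp]: "chain_tops (Leaf a) = {}"
  by (simp add: chain_tops_def)

text \<open>The root chain of the right subtree is absorbed into that of the whole tree, so its top
  disappears; all other chains survive.\<close>

lemma chain_tops_Node:
  "chain_tops (Node l r) = insert [] (Cons False ` chain_tops l \<union> Cons True ` (chain_tops r - {[]}))"
  by (auto simp: chain_tops_def split: if_splits)

lemma chain_block_Node:
  "chain_block (Node l r) [] = insert [] (Cons True ` chain_block r [])"
  "chain_block (Node l r) (False # y) = Cons False ` chain_block l y"
  "y \<noteq> [] \<Longrightarrow> chain_block (Node l r) (True # y) = Cons True ` chain_block r y"
  by (auto simp: chain_block_def split: if_splits)

lemma card_chain_block_Nil: "card (chain_block t []) = spine_length t"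
proof (induction t)
  case (Node l r)
  have "finite (chain_block r [])" by (simp add: chain_block_def)
  thus ?case
    using Node.IH(2) by (subst chain_block_Node) (simp add: card_insert_if card_image image_iff)
qed (simp add: chain_block_def)

text \<open>The type matching \<open>part_colourings\<close>. Applied to a right child, it leaves
  out the chain that continues the chain of the parent.\<close>

definition lower_comb_type :: "'a lbtree \<Rightarrow> nat multiset" where
  "lower_comb_type t = image_mset (\<lambda>y. card (chain_block t y)) (mset_set (chain_tops t - {[]}))"

lemma comb_type_eq:
  "comb_type t = image_mset (\<lambda>y. card (chain_block t y)) (mset_set (chain_tops t))"
proof -
  \<comment> \<open>Distinct tops give distinct blocks, so multiplicities survive the passage from
    tops to blocks.\<close>
  have "inj_on (chain_block t) (chain_tops t)"
  proof (rule inj_onI)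
    fix x y assume "x \<in> chain_tops t" "chain_block t x = chain_block t y"
    hence "x \<in> chain_block t y" by (auto simp: chain_block_def chain_tops_def)
    moreover assume "x \<in> chain_tops t"
    ultimately show "x = y" by (simp add: chain_block_def chain_tops_def)
  qed
  hence "mset_set (chain_block t ` chain_tops t) = image_mset (chain_block t) (mset_set (chain_tops t))"
    by (rule image_mset_mset_set[symmetric])
  thus ?thesis
    by (simp add: comb_type_def comb_partition_eq multiset.map_comp comp_def)
qed

lemma comb_type_Leaf [simp]: "comb_type (Leaf a) = {#}"
  by (simp add: comb_type_eq)

lemma comb_type_Node: "comb_type (Node l r) = add_mset (spine_length (Node l r)) (lower_comb_type (Node l r))"
proof -
  have "[] \<in> chain_tops (Node l r)" by (simp add: chain_tops_Node)
  hence "mset_set (chain_tops (Node l r)) = add_mset [] (mset_set (chain_tops (Node l r) - {[]}))"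
    by (simp add: mset_set.remove)
  thus ?thesis
    by (simp add: comb_type_eq lower_comb_type_def card_chain_block_Nil del: spine_length.simps)
qed

lemma lower_comb_type_Node: "lower_comb_type (Node l r) = comb_type l + lower_comb_type r"
proof -
  have "chain_tops (Node l r) - {[]} = Cons False ` chain_tops l \<union> Cons True ` (chain_tops r - {[]})"
    by (auto simp: chain_tops_Node)
  hence "mset_set (chain_tops (Node l r) - {[]})
      = mset_set (Cons False ` chain_tops l) + mset_set (Cons True ` (chain_tops r - {[]}))"
    by (simp only:) (rule mset_set_Union, auto)
  hence mset: "mset_set (chain_tops (Node l r) - {[]})
      = image_mset (Cons False) (mset_set (chain_tops l)) + image_mset (Cons True) (mset_set (chain_tops r - {[]}))"
    by (simp add: image_mset_mset_set)
  have False: "card (chain_block (Node l r) (False # y)) = card (chain_block l y)" for y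
    by (simp add: chain_block_Node card_image)
  have True: "card (chain_block (Node l r) (True # y)) = card (chain_block r y)"
    if "y \<in># mset_set (chain_tops r - {[]})" for y
    using that by (simp add: chain_block_Node card_image)
  show ?thesis
    unfolding lower_comb_type_def comb_type_eq mset image_mset_union multiset.map_comp comp_def False
    by (intro arg_cong2[where f = "(+)"] refl image_mset_cong True)
qed

text \<open>Both claims are proved together: the left child enters with all its blocks, the right
  child only with those below its spine.\<close>

lemma count_series_eq_elem_sym_partition:
  "count_series parts_content (part_colourings t :: ('c::linorder, 'a) bracketing list set)
    = elem_sym_partition (lower_comb_type t)"
  "count_series colour_content (colourings t :: ('c, 'a) bracketing set) = elem_sym_partition (comb_type t)"
proof (induction t)
  case (Leaf a)
  have parts: "count_series parts_content (part_colourings (Leaf a) :: ('c, 'a) bracketing list set)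
      = elem_sym_partition (lower_comb_type (Leaf a))"
    unfolding count_series_part_colourings by (simp add: lower_comb_type_def elem_sym_partition_def)
  {
    case 1
    show ?case by (rule parts)
  next
    case 2
    \<comment> \<open>An empty spine contributes \<open>elem_sym 0\<close>, which is 1 and agrees
      with the empty comb type of a leaf.\<close>
    show ?case
      unfolding count_series_colourings(2)[OF graded_part_colourings] parts
      by (simp add: lower_comb_type_def elem_sym_partition_def elem_sym_0)
  }
next
  case (Node l r)
  have parts: "count_series parts_content (part_colourings (Node l r) :: ('c, 'a) bracketing list set)
      = elem_sym_partition (lower_comb_type (Node l r))"
    unfolding count_series_part_colourings Node.IH
    by (simp add: lower_comb_type_Node elem_sym_partition_def)
  {
    case 1
    show ?case by (rule parts)
  next
    case 2
    show ?case
      unfolding count_series_colourings(2)[OF graded_part_colourings] parts comb_type_Node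
      by (simp add: elem_sym_partition_def)
  }
qed

section \<open>Normalized trees and the final count\<close>

lemma leaves_shape: "leaves (shape T) = gens_list T"
  by (induction T) auto

lemma leaves_nonempty [simp]: "leaves t \<noteq> []"
  by (induction t) auto

lemma normalized_Node:
  "normalized (Node l r) \<longleftrightarrow>
    normalized l \<and> normalized r \<and> hd (leaves l) = Min (set (leaves l) \<union> set (leaves r))"
  by (auto simp: normalized_def)

lemma normalized_hd: "normalized t \<Longrightarrow> hd (leaves t) = Min (set (leaves t))"
  by (cases t) (auto simp: normalized_def)

lemma least_label_eq_Min: "least_label T = Min (set (leaves (shape T)))"
  by (simp add: least_label_def leaves_shape flip: mset_gens_list)

text \<open>In a normalized left subtree the leftmost leaf carries the least label; distinct labels
  make the comparison with the right factor strict.\<close>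

lemma normalized_shape: "distinct (leaves (shape T)) \<Longrightarrow> normalized (shape T) \<longleftrightarrow> increasing T"
proof (induction T)
  case (Br i s t)
  have d: "distinct (leaves (shape s))" "distinct (leaves (shape t))" "set (leaves (shape s)) \<inter> set (leaves (shape t)) = {}"
    using Br.prems by simp_all
  have "set (leaves (shape T)) = set_mset (labels T)" for T :: "('a, nat) bracketing"
    by (simp add: leaves_shape flip: mset_gens_list)
  with d(3) have "least_label s \<noteq> least_label t"
    by (intro least_label_neq) simp
  hence "least_label s = min (least_label s) (least_label t) \<longleftrightarrow> least_label s < least_label t"
    by (auto simp: min_def)
  moreover have "Min (set (leaves (shape s)) \<union> set (leaves (shape t))) = min (least_label s) (least_label t)"
    unfolding least_label_eq_Min by (rule Min_Un) simp_all
  moreover have "hd (leaves (shape s)) = least_label s" if "normalized (shape s)"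
    using normalized_hd[OF that] by (simp add: least_label_eq_Min)
  ultimately show ?case
    using Br.IH(1)[OF d(1)] Br.IH(2)[OF d(2)] by (auto simp: normalized_Node)
qed (simp add: normalized_def)

lemma normal_combs_eq: "normal_combs n = {T. comb T \<and> shape T \<in> Nor n}"
proof -
  have "increasing T \<and> distinct (gens_list T) \<and> set (gens_list T) = {1..n} \<longleftrightarrow>
      distinct (leaves (shape T)) \<and> set (leaves (shape T)) = {1..n} \<and> normalized (shape T)"
    for T :: "('a, nat) bracketing"
    using normalized_shape[of T] unfolding leaves_shape by blast
  thus ?thesis
    unfolding normal_combs_def Nor_def mset_gens_list[symmetric] distinct_set_iff_mset[symmetric] by simp
qed

lemma size_labels_eq: "size (labels t) = Suc (size (colours t))"
  by (induction t) auto

text \<open>A binary tree with \<open>n\<close> leaves has \<open>n - 1\<close> internal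
  nodes.\<close>

lemma colour_content_in_WComp:
  assumes "t \<in> normal_combs n"
  shows "colour_content t \<in> WComp (n - 1)"
proof -
  have keys: "Poly_Mapping.keys (colour_content t) = set_mset (colours t)"
    by (auto simp: in_keys_iff lookup_colour_content simp flip: count_greater_zero_iff)
  have "labels t = mset_set {1..n}"
    using assms by (simp add: normal_combs_def)
  hence "size (colours t) = n - 1"
    using size_labels_eq[of t] by simp
  thus ?thesis
    unfolding WComp_def mem_Collect_eq keys lookup_colour_content size_multiset_overloaded_eq .
qed

theorem theorem1p6:
  fixes n :: nat
  assumes "n \<ge> 1"
  shows "gen_series (WComp (n - 1))
           (\<lambda>\<mu>. int (lie_dim (Lie n \<mu> :: (num, nat, 'k :: field) free_lie set)))
         = (\<Sum>\<Upsilon>\<in>Nor n. elem_sym_partition (comb_type \<Upsilon>) :: (num, int) mps)"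
proof (rule mps_eqI)
  fix \<mu> :: "num \<Rightarrow>\<^sub>0 nat"
  let ?C = "\<lambda>\<Upsilon>. {T \<in> colourings \<Upsilon>. colour_content T = \<mu>} :: (num, nat) bracketing set"
  have nth_sum: "mps_nth (sum f A) \<mu> = (\<Sum>x\<in>A. mps_nth (f x) \<mu>)"
    for f :: "nat lbtree \<Rightarrow> (num, int) mps" and A
    by (induction A rule: infinite_finite_induct) (simp_all add: zero_mps.rep_eq plus_mps.rep_eq)
  \<comment> \<open>The combs are sorted by their underlying tree.\<close>
  have "{T \<in> normal_combs n. colour_content T = \<mu>} = (\<Union>\<Upsilon>\<in>Nor n. ?C \<Upsilon>)"
    by (auto simp: normal_combs_eq colourings_def)
  moreover have "card (\<Union>\<Upsilon>\<in>Nor n. ?C \<Upsilon>) = (\<Sum>\<Upsilon>\<in>Nor n. card (?C \<Upsilon>))"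
  proof (rule card_UN_disjoint)
    show "\<forall>\<Upsilon>\<in>Nor n. finite (?C \<Upsilon>)"
      using count_series_colourings(1)[OF graded_part_colourings] unfolding graded_def by blast
  qed (auto simp: finite_Nor colourings_def)
  ultimately have card: "card {T \<in> normal_combs n. colour_content T = \<mu>} = (\<Sum>\<Upsilon>\<in>Nor n. card (?C \<Upsilon>))"
    by simp
  have "mps_nth (\<Sum>\<Upsilon>\<in>Nor n. elem_sym_partition (comb_type \<Upsilon>) :: (num, int) mps) \<mu>
      = (\<Sum>\<Upsilon>\<in>Nor n. int (card (?C \<Upsilon>)))"
    unfolding nth_sum by (simp add: count_series_def flip: count_series_eq_elem_sym_partition(2))
  also have "\<dots> = int (card {T \<in> normal_combs n. colour_content T = \<mu>})"
    by (simp add: card)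
  \<comment> \<open>No normal comb has content outside \<open>WComp (n - 1)\<close>, so the
    truncation in \<open>gen_series\<close> loses nothing.\<close>
  also have "\<dots> = (if \<mu> \<in> WComp (n - 1)
      then int (card {T \<in> normal_combs n. colour_content T = \<mu>}) else 0)"
    using colour_content_in_WComp by (auto intro!: card_eq_0_iff[THEN iffD2])
  finally show "mps_nth (gen_series (WComp (n - 1))
        (\<lambda>\<mu>. int (lie_dim (Lie n \<mu> :: (num, nat, 'k) free_lie set)))) \<mu>
      = mps_nth (\<Sum>\<Upsilon>\<in>Nor n. elem_sym_partition (comb_type \<Upsilon>) :: (num, int) mps) \<mu>"
    by (simp add: gen_series_def lie_dim_Lie)
qed

end
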